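(* Let $\mathcal T$ be a quadrilateral tiling of the sphere. Then for every division ring $\mathbb D$ and every dimension $n\ge1$, the incidence theorem in $\mathbb P^n(\mathbb D)$ associated with $\mathcal T$ holds: for every realization of $\mathcal T$ in $\mathbb P^n(\mathbb D)$, if all tiles except one are coherent, then the remaining tile is also coherent.
   Context: A polygonal subdivision of a closed surface is a cellular decomposition in which the closure of every $2$-cell is an embedded polygon with at least two vertices. A quadrilateral tiling is a polygonal subdivision in which all faces (tiles) are quadrilaterals and vertices are colored black and white so that every edge joins vertices of different colors. $\mathbb P^n(\mathbb D)$ is the left projective space over $\mathbb D$; hyperplanes correspond to rank-$n$ left submodules of $\mathbb D^{n+1}$. A realization of $\mathcal T$ in $\mathbb P^n(\mathbb D)$ assigns a point to each black vertex and a hyperplane to each white vertex such that for every edge the point and the hyperplane at its endpoints are not incident. A tile with black-vertex points $A_1,A_2$ and white-vertex hyperplanes $\ell_1,\ell_2$ is coherent if $A_1=A_2$, or $\ell_1=\ell_2$, or the line $A_1A_2$ and the codimension-$2$ subspace $\ell_1\cap\ell_2$ have nonempty intersection. *)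

theory Defs
  imports "HOL-Analysis.Analysis"
begin

section \<open>Polygonal subdivisions and quadrilateral tilings\<close>

text \<open>
  A cell decomposition of a compact space \<open>X\<close> is given by a set \<open>V\<close> of points (the 0-cells), a set
  \<open>E\<close> of open 1-cells and a set \<open>F\<close> of open 2-cells, that is, by a finite CW structure. Edges and
  faces are point sets, so several edges may have the same end points.
\<close>

definition cellular_decomposition ::
    "'a::t2_space set \<Rightarrow> 'a set \<Rightarrow> 'a set set \<Rightarrow> 'a set set \<Rightarrow> bool" where
  "cellular_decomposition X V E F \<longleftrightarrow>
     finite V \<and> finite E \<and> finite F \<and>
     V \<union> \<Union>E \<union> \<Union>F = X \<and>
     V \<inter> \<Union>E = {} \<and> V \<inter> \<Union>F = {} \<and> \<Union>E \<inter> \<Union>F = {} \<and>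
     pairwise disjnt E \<and> pairwise disjnt F \<and>
     (\<forall>e\<in>E. \<exists>\<gamma> \<gamma>'. continuous_on {0..1::real} \<gamma> \<and>
        homeomorphism {0<..<1} e \<gamma> \<gamma>' \<and> \<gamma> 0 \<in> V \<and> \<gamma> 1 \<in> V) \<and>
     (\<forall>f\<in>F. \<exists>\<phi> \<phi>'. continuous_on (cball (0::complex) 1) \<phi> \<and>
        homeomorphism (ball 0 1) f \<phi> \<phi>' \<and> \<phi> ` sphere 0 1 \<subseteq> V \<union> \<Union>E)"

text \<open>
  The closure of \<open>f\<close> is an embedded \<open>k\<close>-gon: the closed unit disk, whose boundary circle is cut
  into \<open>k\<close> arcs at the \<open>k\<close>-th roots of unity, is mapped homeomorphically onto the closure of \<open>f\<close>,
  with corners going to vertices and open sides going to (entire) edges. The corners are therefore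
  pairwise distinct, and so are the sides.
\<close>

definition embedded_polygon ::
    "'a::t2_space set \<Rightarrow> 'a set set \<Rightarrow> nat \<Rightarrow> 'a set \<Rightarrow> bool" where
  "embedded_polygon V E k f \<longleftrightarrow>
     (\<exists>\<phi> \<phi>'. homeomorphism (cball (0::complex) 1) (closure f) \<phi> \<phi>' \<and>
        \<phi> ` ball 0 1 = f \<and>
        (\<forall>j<k. \<phi> (cis (2 * pi * real j / real k)) \<in> V) \<and>
        (\<forall>j<k. \<phi> ` cis ` {2 * pi * real j / real k <..< 2 * pi * real (j + 1) / real k} \<in> E))"

definition polygonal_subdivision ::
    "'a::t2_space set \<Rightarrow> 'a set \<Rightarrow> 'a set set \<Rightarrow> 'a set set \<Rightarrow> bool" where
  "polygonal_subdivision X V E F \<longleftrightarrow>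
     cellular_decomposition X V E F \<and> (\<forall>f\<in>F. \<exists>k\<ge>2. embedded_polygon V E k f)"

text \<open>The end points of an edge, or the corners of a face.\<close>

definition cell_vertices :: "'a::t2_space set \<Rightarrow> 'a set \<Rightarrow> 'a set" where
  "cell_vertices V c = closure c \<inter> V"

text \<open>\<open>B\<close> and \<open>W\<close> are the sets of black and of white vertices.\<close>

definition quadrilateral_tiling ::
    "'a::t2_space set \<Rightarrow> 'a set \<Rightarrow> 'a set set \<Rightarrow> 'a set set \<Rightarrow> 'a set \<Rightarrow> 'a set \<Rightarrow> bool" where
  "quadrilateral_tiling X V E F B W \<longleftrightarrow>
     polygonal_subdivision X V E F \<and>
     (\<forall>f\<in>F. embedded_polygon V E 4 f) \<and>
     V = B \<union> W \<and> B \<inter> W = {} \<and>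
     (\<forall>e\<in>E. \<exists>b\<in>B. \<exists>w\<in>W. cell_vertices V e = {b, w})"


section \<open>Left projective spaces over a division ring\<close>

text \<open>
  The library's linear algebra requires commutative scalars, so the few notions needed are defined
  here. On \<open>'d ^ 'm\<close> the library operation \<open>c *s v\<close> multiplies each coordinate by \<open>c\<close> from the left.
  Projective subspaces are represented by left submodules of \<open>'d ^ 'm\<close>; the projective space has
  dimension \<open>CARD('m) - 1\<close>, and \<open>{0}\<close> represents the empty projective subspace.
\<close>

definition left_submodule :: "('d::division_ring ^ 'm) set \<Rightarrow> bool" where
  "left_submodule U \<longleftrightarrow>
     0 \<in> U \<and> (\<forall>x\<in>U. \<forall>y\<in>U. x + y \<in> U) \<and> (\<forall>c. \<forall>x\<in>U. c *s x \<in> U)"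

definition left_span :: "('d::division_ring ^ 'm) set \<Rightarrow> ('d ^ 'm) set" where
  "left_span S = left_submodule hull S"

definition left_basis :: "('d::division_ring ^ 'm) set \<Rightarrow> ('d ^ 'm) set \<Rightarrow> bool" where
  "left_basis S U \<longleftrightarrow> finite S \<and> left_span S = U \<and>
     (\<forall>c. (\<Sum>v\<in>S. c v *s v) = 0 \<longrightarrow> (\<forall>v\<in>S. c v = 0))"

definition left_rank_is :: "('d::division_ring ^ 'm) set \<Rightarrow> nat \<Rightarrow> bool" where
  "left_rank_is U r \<longleftrightarrow> (\<exists>S. left_basis S U \<and> card S = r)"

definition proj_point :: "('d::division_ring ^ 'm) set \<Rightarrow> bool" where
  "proj_point A \<longleftrightarrow> left_rank_is A 1"

definition proj_hyperplane :: "('d::division_ring ^ 'm) set \<Rightarrow> bool" where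
  "proj_hyperplane L \<longleftrightarrow> left_rank_is L (CARD('m) - 1)"

definition proj_incident :: "('d::division_ring ^ 'm) set \<Rightarrow> ('d ^ 'm) set \<Rightarrow> bool" where
  "proj_incident A L \<longleftrightarrow> A \<subseteq> L"

definition proj_meet :: "('d::division_ring ^ 'm) set \<Rightarrow> ('d ^ 'm) set \<Rightarrow> bool" where
  "proj_meet U U' \<longleftrightarrow> (\<exists>Q. proj_point Q \<and> proj_incident Q U \<and> proj_incident Q U')"


section \<open>Realizations and coherence\<close>

text \<open>Only the values of \<open>P\<close> on \<open>B\<close> and of \<open>H\<close> on \<open>W\<close> matter.\<close>

definition tiling_realization ::
    "'a::t2_space set \<Rightarrow> 'a set set \<Rightarrow> 'a set \<Rightarrow> 'a set \<Rightarrow>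
     ('a \<Rightarrow> ('d::division_ring ^ 'm) set) \<Rightarrow> ('a \<Rightarrow> ('d ^ 'm) set) \<Rightarrow> bool" where
  "tiling_realization V E B W P H \<longleftrightarrow>
     (\<forall>b\<in>B. proj_point (P b)) \<and> (\<forall>w\<in>W. proj_hyperplane (H w)) \<and>
     (\<forall>e\<in>E. \<forall>b\<in>B. \<forall>w\<in>W. cell_vertices V e = {b, w} \<longrightarrow> \<not> proj_incident (P b) (H w))"

text \<open>For \<open>A1 \<noteq> A2\<close> the line \<open>A1A2\<close> is the span of the two submodules.\<close>

definition coherent_quadruple ::
    "('d::division_ring ^ 'm) set \<Rightarrow> ('d ^ 'm) set \<Rightarrow> ('d ^ 'm) set \<Rightarrow> ('d ^ 'm) set \<Rightarrow> bool" where
  "coherent_quadruple A1 A2 L1 L2 \<longleftrightarrow>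
     A1 = A2 \<or> L1 = L2 \<or> proj_meet (left_span (A1 \<union> A2)) (L1 \<inter> L2)"

text \<open>
  A tile of a quadrilateral tiling has exactly two black and two white corners, and
  \<open>coherent_quadruple\<close> is symmetric in each pair, so their order is irrelevant.
\<close>

definition coherent_tile ::
    "'a::t2_space set \<Rightarrow> 'a set \<Rightarrow>
     ('a \<Rightarrow> ('d::division_ring ^ 'm) set) \<Rightarrow> ('a \<Rightarrow> ('d ^ 'm) set) \<Rightarrow> 'a set \<Rightarrow> bool" where
  "coherent_tile B W P H f \<longleftrightarrow>
     (\<exists>b1 b2 w1 w2. b1 \<noteq> b2 \<and> w1 \<noteq> w2 \<and>
        cell_vertices B f = {b1, b2} \<and> cell_vertices W f = {w1, w2} \<and>
        coherent_quadruple (P b1) (P b2) (H w1) (H w2))"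

end

theory Submission
  imports Defs
begin

text \<open>
  Choose a vector \<open>a b\<close> for every point and a linear functional \<open>\<phi> w\<close> for every hyperplane. A tile
  is coherent iff the nonzero scalars \<open>m b w = \<phi> w (a b)\<close> on its four edges have trivial holonomy,
  that is, iff \<open>m\<close> has a potential \<open>g\<close> with \<open>g w = g b * m b w\<close> on its corners. Local potentials
  form a locally constant sheaf on the complement of the exceptional tile, whose fibers are torsors
  under the multiplicative group of the division ring. The complement is a retract of the punctured
  sphere, that is, of the plane, so the pullback of the sheaf to a large square has a section. It
  yields a potential on all edges, and the exceptional tile is coherent as well.
\<close>

section \<open>Coherence in coordinates\<close>

text \<open>The obstacle is that the scalars do not commute. Replacing \<open>a b\<close> by a
  multiple changes \<open>m b w\<close> by a factor on the left, replacing \<open>\<phi> w\<close>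
  by a multiple changes it by a factor on the right, and holonomies based at different vertices are
  comparable only up to conjugation. Multiplying the conditions of all tiles would thus need a
  carefully ordered product. Potentials avoid it: two local ones differ by a single left factor, and
  gluing only needs connected overlaps.

  At a point the local potentials are those on the vertices of the unique cell containing it. Near
  the point this vertex set can only grow, so nearby potentials restrict to the given point, and
  continuity replaces the combinatorics of the tiling.

  No potential is available inside the exceptional tile, but its four sides remain in the
  complement. In a quadrilateral every black corner is joined to every white one by a side, so a
  potential on the edges is already one on that tile.\<close>

text \<open>Gaussian elimination of one equation at a time; scalars act on the left throughout.\<close>

lemma left_dependent:
  fixes v :: "'i \<Rightarrow> 'j \<Rightarrow> 'd::division_ring"
  assumes "finite J" "finite I" "card J < card I"
  shows "\<exists>c. (\<exists>i\<in>I. c i \<noteq> 0) \<and> (\<forall>j\<in>J. (\<Sum>i\<in>I. c i * v i j) = 0)"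
  using assms
proof (induction J arbitrary: I v rule: finite_induct)
  case empty
  then obtain i where "i \<in> I" by fastforce
  then show ?case by (intro exI[of _ "\<lambda>_. 1"]) auto
next
  case (insert k J)
  show ?case
  proof (cases "\<forall>i\<in>I. v i k = 0")
    case True
    have "\<exists>c. (\<exists>i\<in>I. c i \<noteq> 0) \<and> (\<forall>j\<in>J. (\<Sum>i\<in>I. c i * v i j) = 0)"
      using insert.prems insert.hyps by (intro insert.IH) auto
    then obtain c where "\<exists>i\<in>I. c i \<noteq> 0" "\<forall>j\<in>J. (\<Sum>i\<in>I. c i * v i j) = 0" by blast
    with True show ?thesis by (intro exI[of _ c]) simp
  next
    case False
    then obtain l where l: "l \<in> I" "v l k \<noteq> 0" by blast
    \<comment> \<open>Subtracting \<open>q i\<close> times \<open>v l\<close> from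
      \<open>v i\<close> makes the entry at \<open>k\<close> vanish, which removes one equation at
      the cost of one vector.\<close>
    define q where "q i = v i k * inverse (v l k)" for i
    have "\<exists>c. (\<exists>i\<in>I - {l}. c i \<noteq> 0) \<and>
      (\<forall>j\<in>J. (\<Sum>i\<in>I - {l}. c i * (v i j - q i * v l j)) = 0)"
      using insert.prems insert.hyps l by (intro insert.IH) auto
    then obtain c where c: "\<exists>i\<in>I - {l}. c i \<noteq> 0"
      and c0: "\<And>j. j \<in> J \<Longrightarrow> (\<Sum>i\<in>I - {l}. c i * (v i j - q i * v l j)) = 0" by blast
    \<comment> \<open>The coefficient of \<open>l\<close> collects the multiples of
      \<open>v l\<close> that were subtracted from the other vectors.\<close>
    define d where "d = c(l := - (\<Sum>i\<in>I - {l}. c i * q i))"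
    have eq: "(\<Sum>i\<in>I. d i * v i j) = (\<Sum>i\<in>I - {l}. c i * (v i j - q i * v l j))" for j
    proof -
      have "(\<Sum>i\<in>I. d i * v i j) = d l * v l j + (\<Sum>i\<in>I - {l}. d i * v i j)"
        using l insert.prems by (simp add: sum.remove)
      also have "(\<Sum>i\<in>I - {l}. d i * v i j) = (\<Sum>i\<in>I - {l}. c i * v i j)"
        by (intro sum.cong) (auto simp: d_def)
      also have "d l * v l j = - (\<Sum>i\<in>I - {l}. c i * q i * v l j)"
        by (simp add: d_def sum_distrib_right)
      finally show ?thesis by (simp add: right_diff_distrib sum_subtractf mult.assoc)
    qed
    have "q i * v l k = v i k" for i using l by (simp add: q_def mult.assoc)
    then have "(\<Sum>i\<in>I. d i * v i k) = 0" using eq[of k] by simp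
    moreover have "\<exists>i\<in>I. d i \<noteq> 0" using c by (auto simp: d_def)
    ultimately show ?thesis using eq c0 by (intro exI[of _ d]) auto
  qed
qed

lemma left_dependent_vec:
  fixes T :: "('d::division_ring ^ 'm::finite) set"
  assumes "finite T" "CARD('m) < card T"
  obtains c where "\<exists>t\<in>T. c t \<noteq> 0" "(\<Sum>t\<in>T. c t *s t) = 0"
proof -
  obtain c where "\<exists>t\<in>T. c t \<noteq> 0" "\<And>j. (\<Sum>t\<in>T. c t * t $ j) = 0"
    using left_dependent[of "UNIV :: 'm set" T "\<lambda>t j. t $ j"] assms by auto
  then show ?thesis by (intro that[of c]) (auto simp: vec_eq_iff)
qed

section \<open>Points and hyperplanes in coordinates\<close>

lemma left_submodule_hull: "left_submodule (left_submodule hull S)"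
  by (rule hull_in) (auto simp: left_submodule_def)

lemma left_submodule_sum:
  assumes "left_submodule U" "\<And>i. i \<in> I \<Longrightarrow> f i \<in> U"
  shows "sum f I \<in> U"
  using assms by (induction I rule: infinite_finite_induct) (auto simp: left_submodule_def)

lemma left_submodule_diff:
  fixes U :: "('d::division_ring ^ 'm) set"
  assumes "left_submodule U" "x \<in> U" "y \<in> U"
  shows "x - y \<in> U"
proof -
  have "x + (- 1) *s y \<in> U" using assms unfolding left_submodule_def by blast
  moreover have "x + (- 1) *s y = x - y" by (simp add: vec_eq_iff)
  ultimately show ?thesis by simp
qed

lemma left_span_singleton:
  "left_span {a} = range (\<lambda>c. c *s (a :: 'd::division_ring ^ 'm))"
  unfolding left_span_def
proof (rule hull_unique)
  have "a = 1 *s a" by simp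
  then show "{a} \<subseteq> range (\<lambda>c. c *s a)" by blast
  have "0 = 0 *s a" by simp
  moreover have "x *s a + y *s a = (x + y) *s a" for x y by (simp add: vector_sadd_rdistrib)
  moreover have "x *s (y *s a) = (x * y) *s a" for x y by (simp add: vector_smult_assoc)
  ultimately show "left_submodule (range (\<lambda>c. c *s a))"
    unfolding left_submodule_def by blast
  show "range (\<lambda>c. c *s a) \<subseteq> U" if "{a} \<subseteq> U" "left_submodule U" for U
    using that by (auto simp: left_submodule_def)
qed

lemma proj_pointE:
  assumes "proj_point (A :: ('d::division_ring ^ 'm) set)"
  obtains a where "a \<noteq> 0" "A = range (\<lambda>c. c *s a)"
proof -
  obtain a where a: "left_basis {a} A"
    using assms by (auto simp: proj_point_def left_rank_is_def card_1_singleton_iff)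
  have "a \<noteq> 0"
  proof
    assume "a = 0"
    have "(\<Sum>v\<in>{a}. c v *s v) = 0 \<longrightarrow> (\<forall>v\<in>{a}. c v = 0)" for c
      using a unfolding left_basis_def by blast
    from this[of "\<lambda>_. 1"] show False using \<open>a = 0\<close> by simp
  qed
  then show ?thesis using a that by (auto simp: left_basis_def left_span_singleton)
qed

lemma proj_pointI:
  assumes "a \<noteq> 0"
  shows "proj_point (range (\<lambda>c. c *s (a :: 'd::division_ring ^ 'm)))"
proof -
  obtain j where j: "a $ j \<noteq> 0" using assms by (auto simp: vec_eq_iff)
  have "c = 0" if "c *s a = 0" for c
    using that j by (metis no_zero_divisors vector_smult_component zero_index)
  then have "left_basis {a} (range (\<lambda>c. c *s a))"
    by (auto simp: left_basis_def left_span_singleton)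
  then show ?thesis by (auto simp: proj_point_def left_rank_is_def intro!: exI[of _ "{a}"])
qed

definition left_functional :: "('d::division_ring ^ 'm \<Rightarrow> 'd) \<Rightarrow> bool" where
  "left_functional \<phi> \<longleftrightarrow> (\<forall>x y. \<phi> (x + y) = \<phi> x + \<phi> y) \<and> (\<forall>c x. \<phi> (c *s x) = c * \<phi> x)"

lemma left_functional_simps:
  assumes "left_functional \<phi>"
  shows "\<phi> (x + y) = \<phi> x + \<phi> y" "\<phi> (c *s x) = c * \<phi> x" "\<phi> (x - y) = \<phi> x - \<phi> y" "\<phi> 0 = 0"
proof -
  show 1: "\<phi> (x + y) = \<phi> x + \<phi> y" "\<phi> (c *s x) = c * \<phi> x" for x y c
    using assms by (auto simp: left_functional_def)
  show "\<phi> (x - y) = \<phi> x - \<phi> y" using 1(1)[of "x - y" y] by simp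
  show "\<phi> 0 = 0" using 1(1)[of 0 0] by simp
qed

text \<open>A hyperplane has a complement spanned by any vector outside it: together with that vector
  and any further one, its basis has more elements than there are coordinates.\<close>

lemma hyperplane_functional:
  fixes L :: "('d::division_ring ^ 'm::finite) set"
  assumes L: "proj_hyperplane L" and u: "u \<notin> L"
  obtains \<phi> where "left_functional \<phi>" "\<And>x. \<phi> x = 0 \<longleftrightarrow> x \<in> L"
proof -
  obtain S where S: "finite S" "left_span S = L" "card S = CARD('m) - 1"
    and ind: "\<And>c. (\<Sum>v\<in>S. c v *s v) = 0 \<Longrightarrow> \<forall>v\<in>S. c v = 0"
    using L by (auto simp: proj_hyperplane_def left_rank_is_def left_basis_def)
  have sub: "left_submodule L" using S left_submodule_hull by (auto simp: left_span_def)
  have SL: "S \<subseteq> L" unfolding S(2)[symmetric] left_span_def by (rule hull_subset)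
  have zeroL: "0 \<in> L" and addL: "\<And>x y. x \<in> L \<Longrightarrow> y \<in> L \<Longrightarrow> x + y \<in> L"
    and scaleL: "\<And>c x. x \<in> L \<Longrightarrow> c *s x \<in> L"
    using sub by (auto simp: left_submodule_def)
  note diffL = left_submodule_diff[OF sub]
  have ex: "\<exists>c. x - c *s u \<in> L" for x
  proof (cases "x \<in> L \<or> x = u")
    case True
    have "x - 0 *s u = x" "u - 1 *s u = 0" by simp_all
    moreover consider "x \<in> L" | "x = u" using True by blast
    ultimately show ?thesis using zeroL by (cases; metis)
  next
    case False
    \<comment> \<open>The case \<open>x = u\<close> had to be split off: \<open>T\<close> must have
      two elements more than \<open>S\<close>.\<close>
    define T where "T = insert x (insert u S)"
    have notin: "x \<notin> insert u S" "u \<notin> S" using False u SL by auto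
    have T: "finite T" "card T = Suc (Suc (card S))" using notin S by (auto simp: T_def)
    then have "CARD('m) < card T" using S by simp
    then obtain c where c: "\<exists>t\<in>T. c t \<noteq> 0" "(\<Sum>t\<in>T. c t *s t) = 0"
      using left_dependent_vec[OF T(1)] by blast
    have sum: "c x *s x + (c u *s u + (\<Sum>v\<in>S. c v *s v)) = 0"
      using c(2) notin S by (simp add: T_def)
    have sumL: "(\<Sum>v\<in>S. c v *s v) \<in> L" using SL scaleL by (intro left_submodule_sum[OF sub]) auto
    \<comment> \<open>Without \<open>x\<close> the relation would put \<open>u\<close> into
      \<open>L\<close> or make the basis \<open>S\<close> dependent.\<close>
    have cx: "c x \<noteq> 0"
    proof
      assume x0: "c x = 0"
      have "c u = 0"
      proof (rule ccontr)
        assume cu: "c u \<noteq> 0"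
        have "c u *s u = 0 - (\<Sum>v\<in>S. c v *s v)" using sum x0 by (simp add: eq_neg_iff_add_eq_0)
        then have "c u *s u \<in> L" using diffL zeroL sumL by metis
        then have "inverse (c u) *s (c u *s u) \<in> L" by (rule scaleL)
        then show False using u cu by (simp add: vector_smult_assoc)
      qed
      then show False using sum x0 ind[of c] c(1) by (auto simp: T_def)
    qed
    define d where "d = - (inverse (c x) * c u)"
    have "inverse (c x) *s (c x *s x + (c u *s u + (\<Sum>v\<in>S. c v *s v))) = 0"
      unfolding sum by (simp add: vec_eq_iff)
    then have "x + (inverse (c x) * c u) *s u + inverse (c x) *s (\<Sum>v\<in>S. c v *s v) = 0"
      using cx by (simp add: vector_add_ldistrib vector_smult_assoc add.assoc)
    moreover have "x - d *s u = (x + (inverse (c x) * c u) *s u + inverse (c x) *s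
        (\<Sum>v\<in>S. c v *s v)) - inverse (c x) *s (\<Sum>v\<in>S. c v *s v)"
      by (simp add: d_def vec_eq_iff)
    ultimately have "x - d *s u = 0 - inverse (c x) *s (\<Sum>v\<in>S. c v *s v)" by simp
    then show ?thesis using diffL zeroL sumL scaleL by metis
  qed
  have uniq: "c = d" if "x - c *s u \<in> L" "x - d *s u \<in> L" for x c d
  proof (rule ccontr)
    assume "c \<noteq> d"
    have "(d - c) *s u \<in> L"
      using diffL[OF that] by (simp add: vector_sub_rdistrib)
    then have "inverse (d - c) *s ((d - c) *s u) \<in> L" by (rule scaleL)
    then show False using u \<open>c \<noteq> d\<close> by (simp add: vector_smult_assoc del: vector_sub_rdistrib)
  qed
  \<comment> \<open>The functional is the coefficient of \<open>u\<close> in the splitting of the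
    space into \<open>L\<close> and the line of \<open>u\<close>.\<close>
  define \<phi> where "\<phi> x = (SOME c. x - c *s u \<in> L)" for x
  have mem: "x - \<phi> x *s u \<in> L" for x unfolding \<phi>_def by (rule someI_ex[OF ex])
  have eqI: "\<phi> x = c" if "x - c *s u \<in> L" for x c using uniq[OF mem that] .
  show ?thesis
  proof
    show "left_functional \<phi>"
      unfolding left_functional_def
    proof (intro conjI allI)
      fix x y c
      have "x + y - (\<phi> x + \<phi> y) *s u = (x - \<phi> x *s u) + (y - \<phi> y *s u)"
        by (simp add: vector_sadd_rdistrib)
      then show "\<phi> (x + y) = \<phi> x + \<phi> y" using addL mem by (intro eqI) metis
      have "c *s x - (c * \<phi> x) *s u = c *s (x - \<phi> x *s u)"
        by (simp add: vector_ssub_ldistrib vector_smult_assoc)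
      then show "\<phi> (c *s x) = c * \<phi> x" using scaleL mem by (intro eqI) metis
    qed
    show "\<phi> x = 0 \<longleftrightarrow> x \<in> L" for x
      using mem[of x] eqI[of x 0] by auto
  qed
qed

section \<open>Coherence as an equation between scalars\<close>

lemma left_span_union_lines:
  fixes a1 a2 :: "'d::division_ring ^ 'm"
  shows "left_span (range (\<lambda>c. c *s a1) \<union> range (\<lambda>c. c *s a2)) = {x *s a1 + y *s a2 |x y. True}"
  unfolding left_span_def
proof (rule hull_unique)
  show "range (\<lambda>c. c *s a1) \<union> range (\<lambda>c. c *s a2) \<subseteq> {x *s a1 + y *s a2 |x y. True}"
  proof -
    have "c *s a1 = c *s a1 + 0 *s a2" "c *s a2 = 0 *s a1 + c *s a2" for c
      by (auto simp: vec_eq_iff)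
    then show ?thesis by blast
  qed
  have "0 = 0 *s a1 + 0 *s a2" by simp
  moreover have "(x *s a1 + y *s a2) + (x' *s a1 + y' *s a2) = (x + x') *s a1 + (y + y') *s a2"
    for x y x' y' by (simp add: vector_sadd_rdistrib)
  moreover have "c *s (x *s a1 + y *s a2) = (c * x) *s a1 + (c * y) *s a2" for c x y
    by (simp add: vector_add_ldistrib vector_smult_assoc)
  ultimately show "left_submodule {x *s a1 + y *s a2 |x y. True}"
    unfolding left_submodule_def by blast
  fix U assume "range (\<lambda>c. c *s a1) \<union> range (\<lambda>c. c *s a2) \<subseteq> U" "left_submodule U"
  then show "{x *s a1 + y *s a2 |x y. True} \<subseteq> U"
    unfolding left_submodule_def by blast
qed

text \<open>Each of the three alternatives yields one scalar \<open>c\<close> with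
  \<open>\<phi>1 a1 = c * \<phi>1 a2\<close> and \<open>\<phi>2 a1 = c * \<phi>2 a2\<close>; it
  cancels in the quotients. Conversely, equal quotients put \<open>a1 - c *s a2\<close> into both
  kernels: either this vector is zero and the points coincide, or it spans a common point of the
  line and \<open>L1 \<inter> L2\<close>.\<close>

lemma coherent_quadruple_iff:
  fixes a1 a2 :: "'d::division_ring ^ 'm"
  assumes A: "A1 = range (\<lambda>c. c *s a1)" "A2 = range (\<lambda>c. c *s a2)"
    and lin: "left_functional \<phi>1" "left_functional \<phi>2"
    and ker: "\<And>x. \<phi>1 x = 0 \<longleftrightarrow> x \<in> L1" "\<And>x. \<phi>2 x = 0 \<longleftrightarrow> x \<in> L2"
    and nz: "\<phi>1 a1 \<noteq> 0" "\<phi>1 a2 \<noteq> 0" "\<phi>2 a1 \<noteq> 0" "\<phi>2 a2 \<noteq> 0"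
  shows "coherent_quadruple A1 A2 L1 L2 \<longleftrightarrow>
    inverse (\<phi>1 a1) * \<phi>2 a1 = inverse (\<phi>1 a2) * \<phi>2 a2"
proof -
  note f = left_functional_simps[OF lin(1)] left_functional_simps[OF lin(2)]
  have eq: "inverse (\<phi>1 a1) * \<phi>2 a1 = inverse (\<phi>1 a2) * \<phi>2 a2"
    if "\<phi>1 a1 = c * \<phi>1 a2" "\<phi>2 a1 = c * \<phi>2 a2" for c
  proof -
    have "c \<noteq> 0" using that nz by auto
    then have "inverse c * (c * \<phi>2 a2) = \<phi>2 a2" by (simp flip: mult.assoc)
    then show ?thesis
      using \<open>c \<noteq> 0\<close> nz by (simp add: that nonzero_inverse_mult_distrib mult.assoc)
  qed
  \<comment> \<open>The only scalar for which \<open>a1 - c *s a2\<close> lies in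
    \<open>L1\<close>.\<close>
  define c where "c = \<phi>1 a1 * inverse (\<phi>1 a2)"
  have c: "\<phi>1 a1 = c * \<phi>1 a2" "c \<noteq> 0" using nz by (auto simp: c_def mult.assoc)
  then have q1: "\<phi>1 (a1 - c *s a2) = 0" by (simp add: f)
  show ?thesis
  proof
    assume "coherent_quadruple A1 A2 L1 L2"
    then consider "A1 = A2" | "L1 = L2" | "proj_meet (left_span (A1 \<union> A2)) (L1 \<inter> L2)"
      by (auto simp: coherent_quadruple_def)
    then show "inverse (\<phi>1 a1) * \<phi>2 a1 = inverse (\<phi>1 a2) * \<phi>2 a2"
    proof cases
      case 1
      have "a1 = 1 *s a1" by simp
      then have "a1 \<in> A2" using A 1 by blast
      then obtain d where "a1 = d *s a2" using A by auto
      then show ?thesis by (intro eq[of d]) (auto simp: f)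
    next
      case 2
      then have "\<phi>2 (a1 - c *s a2) = 0" using q1 ker by auto
      then show ?thesis using c by (intro eq[of c]) (auto simp: f)
    next
      case 3
      then obtain Q where Q: "proj_point Q" "Q \<subseteq> left_span (A1 \<union> A2)" "Q \<subseteq> L1 \<inter> L2"
        by (auto simp: proj_meet_def proj_incident_def)
      obtain q where q: "q \<noteq> 0" "Q = range (\<lambda>c. c *s q)" using Q(1) by (rule proj_pointE)
      have "q = 1 *s q" by simp
      then have "q \<in> Q" using q by blast
      then obtain x y where xy: "q = x *s a1 + y *s a2"
        using Q(2) A by (auto simp: left_span_union_lines)
      have "\<phi>1 q = 0" "\<phi>2 q = 0" using Q(3) \<open>q \<in> Q\<close> ker by auto
      then have s: "x * \<phi>1 a1 = - (y * \<phi>1 a2)" "x * \<phi>2 a1 = - (y * \<phi>2 a2)"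
        using xy by (auto simp: f eq_neg_iff_add_eq_0)
      have "x \<noteq> 0"
      proof
        assume "x = 0"
        with s nz have "y = 0" by auto
        with \<open>x = 0\<close> xy q show False by simp
      qed
      then have "\<phi>1 a1 = inverse x * (x * \<phi>1 a1)" "\<phi>2 a1 = inverse x * (x * \<phi>2 a1)"
        by (simp_all flip: mult.assoc)
      then show ?thesis unfolding s by (intro eq[of "- (inverse x * y)"]) (auto simp: mult.assoc)
    qed
  next
    assume e: "inverse (\<phi>1 a1) * \<phi>2 a1 = inverse (\<phi>1 a2) * \<phi>2 a2"
    have "\<phi>2 a1 = \<phi>1 a1 * (inverse (\<phi>1 a1) * \<phi>2 a1)" using nz by (simp flip: mult.assoc)
    also have "\<dots> = c * \<phi>2 a2" unfolding e by (simp add: c_def mult.assoc)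
    finally have q2: "\<phi>2 (a1 - c *s a2) = 0" by (simp add: f)
    define q where "q = a1 - c *s a2"
    show "coherent_quadruple A1 A2 L1 L2"
    proof (cases "q = 0")
      case True
      then have a1: "a1 = c *s a2" by (simp add: q_def)
      have "d *s a1 = (d * c) *s a2" "d *s a2 = (d * inverse c) *s a1" for d
        using c by (simp_all add: a1 vector_smult_assoc mult.assoc)
      then have "A1 = A2" unfolding A by blast
      then show ?thesis by (simp add: coherent_quadruple_def)
    next
      case False
      have "d *s q = d *s a1 + (- (d * c)) *s a2" for d
        by (simp add: q_def vec_eq_iff right_diff_distrib mult.assoc)
      then have "range (\<lambda>c. c *s q) \<subseteq> left_span (A1 \<union> A2)"
        unfolding A left_span_union_lines by blast
      moreover have "range (\<lambda>c. c *s q) \<subseteq> L1 \<inter> L2"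
        using q1 q2 by (auto simp: f simp flip: ker q_def)
      ultimately show ?thesis
        using proj_pointI[OF False] by (auto simp: coherent_quadruple_def proj_meet_def proj_incident_def)
    qed
  qed
qed

section \<open>Flat sections\<close>

text \<open>No edge relation occurs: \<open>A\<close> will be the vertex set of a vertex, an edge or
  a tile, where every black and every white vertex are joined by an edge.\<close>

definition flat_on ::
    "('v \<Rightarrow> 'v \<Rightarrow> 'd::division_ring) \<Rightarrow> 'v set \<Rightarrow> 'v set \<Rightarrow> 'v set \<Rightarrow> ('v \<Rightarrow> 'd) \<Rightarrow> bool" where
  "flat_on m B W A g \<longleftrightarrow> (\<forall>v\<in>A. g v \<noteq> 0) \<and> (\<forall>b\<in>B \<inter> A. \<forall>w\<in>W \<inter> A. g w = g b * m b w)"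

text \<open>The shape of the vertex set of a cell. It guarantees that the complete bipartite graph
  on \<open>A\<close> is connected, so that potentials on \<open>A\<close> are unique up to a left
  factor.\<close>

definition bicolored_cell :: "'v set \<Rightarrow> 'v set \<Rightarrow> 'v set \<Rightarrow> bool" where
  "bicolored_cell B W A \<longleftrightarrow>
     A \<subseteq> B \<union> W \<and> ((\<exists>v. A = {v}) \<or> (A \<inter> B \<noteq> {} \<and> A \<inter> W \<noteq> {}))"

lemma flat_on_subset: "flat_on m B W A' g \<Longrightarrow> A \<subseteq> A' \<Longrightarrow> flat_on m B W A g"
  unfolding flat_on_def by blast

lemma flat_on_scale: "flat_on m B W A g \<Longrightarrow> a \<noteq> 0 \<Longrightarrow> flat_on m B W A (\<lambda>v. a * g v)"
  unfolding flat_on_def by (simp add: mult.assoc)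

lemma flat_on_cong:
  assumes "\<And>v. v \<in> A \<Longrightarrow> g v = g' v"
  shows "flat_on m B W A g \<longleftrightarrow> flat_on m B W A g'"
  using assms unfolding flat_on_def by auto

lemma bicolored_cell_nonempty: "bicolored_cell B W A \<Longrightarrow> \<exists>v. v \<in> A"
  unfolding bicolored_cell_def by blast

text \<open>The ratio at one black vertex \<open>b\<close> passes to all white vertices, because
  \<open>m b u\<close> multiplies both potentials on the right; cancelling \<open>m u w\<close>
  passes it back from one white vertex to all black ones.\<close>

lemma flat_on_unique:
  assumes A: "bicolored_cell B W A" and g: "flat_on m B W A g" and g': "flat_on m B W A g'"
  obtains a where "a \<noteq> 0" "\<And>v. v \<in> A \<Longrightarrow> g' v = a * g v"
proof -
  consider v where "A = {v}" | b w where "b \<in> A \<inter> B" "w \<in> A \<inter> W"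
    using A by (auto simp: bicolored_cell_def)
  then show ?thesis
  proof cases
    case 1
    then show ?thesis using g g'
      by (intro that[of "g' v * inverse (g v)"]) (auto simp: flat_on_def mult.assoc)
  next
    case 2
    define a where "a = g' b * inverse (g b)"
    have nz: "g b \<noteq> 0" "g' b \<noteq> 0" "g w \<noteq> 0" using g g' 2 by (auto simp: flat_on_def)
    then have a: "a \<noteq> 0" "g' b = a * g b" by (auto simp: a_def mult.assoc)
    have white: "g' u = a * g u" if "u \<in> A \<inter> W" for u
    proof -
      have "g' u = g' b * m b u" "g u = g b * m b u" using g g' that 2 by (auto simp: flat_on_def)
      then show ?thesis using a by (simp add: mult.assoc)
    qed
    have black: "g' u = a * g u" if "u \<in> A \<inter> B" for u
    proof -
      have u: "g' w = g' u * m u w" "g w = g u * m u w" using g g' that 2 by (auto simp: flat_on_def)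
      then have "m u w \<noteq> 0" using nz by auto
      moreover have "g' u * m u w = (a * g u) * m u w" using u white[of w] 2 by (simp only: mult.assoc Int_iff)
      ultimately show ?thesis by (metis mult_right_cancel)
    qed
    show ?thesis
    proof (rule that[of a])
      show "g' u = a * g u" if "u \<in> A" for u
        using A that black white by (auto simp: bicolored_cell_def)
    qed fact
  qed
qed

section \<open>Sections of the sheaf of local potentials and their gluing\<close>

definition flat_section ::
    "('v \<Rightarrow> 'v \<Rightarrow> 'd::division_ring) \<Rightarrow> 'v set \<Rightarrow> 'v set \<Rightarrow> ('x::topological_space \<Rightarrow> 'v set) \<Rightarrow>
     'x set \<Rightarrow> ('x \<Rightarrow> 'v \<Rightarrow> 'd) \<Rightarrow> bool" where
  "flat_section m B W N K s \<longleftrightarrow>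
     (\<forall>x\<in>K. flat_on m B W (N x) (s x) \<and> (\<forall>\<^sub>F y in at x within K. N x \<subseteq> N y \<and> (\<forall>v\<in>N x. s y v = s x v)))"

lemma flat_section_scale:
  assumes "flat_section m B W N K s" "a \<noteq> 0"
  shows "flat_section m B W N K (\<lambda>x v. a * s x v)"
  unfolding flat_section_def
proof (intro ballI conjI)
  fix x assume x: "x \<in> K"
  show "flat_on m B W (N x) (\<lambda>v. a * s x v)"
    using assms x by (auto simp: flat_section_def flat_on_scale)
  have "\<forall>\<^sub>F y in at x within K. N x \<subseteq> N y \<and> (\<forall>v\<in>N x. s y v = s x v)"
    using assms x by (auto simp: flat_section_def)
  then show "\<forall>\<^sub>F y in at x within K. N x \<subseteq> N y \<and> (\<forall>v\<in>N x. a * s y v = a * s x v)"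
    by eventually_elim auto
qed

text \<open>As long as \<open>v\<close> stays in the vertex set, the value of the section at
  \<open>v\<close> is locally constant. This is the parallel transport along an edge.\<close>

lemma flat_section_constant:
  assumes s: "flat_section m B W N K s" and T: "connected T" "T \<subseteq> K"
    and v: "\<And>x. x \<in> T \<Longrightarrow> v \<in> N x" and xy: "x \<in> T" "y \<in> T"
  shows "s x v = s y v"
proof (rule connected_local_const[OF T(1) xy])
  show "\<forall>x\<in>T. \<forall>\<^sub>F y in at x within T. s x v = s y v"
  proof
    fix x assume x: "x \<in> T"
    then have "\<forall>\<^sub>F y in at x within K. N x \<subseteq> N y \<and> (\<forall>v\<in>N x. s y v = s x v)"
      using s T by (auto simp: flat_section_def)
    then have "\<forall>\<^sub>F y in at x within T. N x \<subseteq> N y \<and> (\<forall>v\<in>N x. s y v = s x v)"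
      by (rule filter_leD[OF at_le[OF T(2)]])
    then show "\<forall>\<^sub>F y in at x within T. s x v = s y v"
      by eventually_elim (use v x in auto)
  qed
qed

text \<open>Settles the points that lie in only one of two closed pieces being glued: the other
  piece does not come near them.\<close>

lemma eventually_at_within_closed:
  "closed K \<Longrightarrow> x \<notin> K \<Longrightarrow> eventually P (at x within K)"
  unfolding eventually_at_topological by (intro exI[of _ "- K"]) auto

lemma eventually_at_within_mono:
  "eventually P (at x within T) \<Longrightarrow> S \<subseteq> T \<Longrightarrow> eventually P (at x within S)"
  by (rule filter_leD[OF at_le])

lemma eventually_mem_at_within: "\<forall>\<^sub>F y in at x within K. y \<in> K"
  unfolding eventually_at_topological by (intro exI[of _ UNIV]) auto

text \<open>On the overlap the two sections differ pointwise by a left factor, which is locally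
  constant, hence constant by connectedness; rescaling the first section removes it. Closedness of
  the pieces allows the local condition on the union to be checked along each piece
  separately.\<close>

lemma flat_section_glue:
  assumes s1: "flat_section m B W N K1 s1" and s2: "flat_section m B W N K2 s2"
    and K: "closed K1" "closed K2" "connected (K1 \<inter> K2)"
    and N: "\<And>x. x \<in> K1 \<inter> K2 \<Longrightarrow> bicolored_cell B W (N x)"
  shows "\<exists>s. flat_section m B W N (K1 \<union> K2) s"
proof -
  obtain a where a: "a \<noteq> 0" "\<And>x v. x \<in> K1 \<inter> K2 \<Longrightarrow> v \<in> N x \<Longrightarrow> s2 x v = a * s1 x v"
  proof (cases "K1 \<inter> K2 = {}")
    case True
    then show ?thesis by (intro that[of 1]) auto
  next
    case False
    then obtain p where p: "p \<in> K1 \<inter> K2" by blast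
    have "\<exists>a. a \<noteq> 0 \<and> (\<forall>v\<in>N x. s2 x v = a * s1 x v)" if x: "x \<in> K1 \<inter> K2" for x
    proof -
      have "flat_on m B W (N x) (s1 x)" "flat_on m B W (N x) (s2 x)"
        using s1 s2 x by (auto simp: flat_section_def)
      from flat_on_unique[OF N[OF x] this] show ?thesis by metis
    qed
    then obtain q where q: "\<And>x. x \<in> K1 \<inter> K2 \<Longrightarrow> q x \<noteq> 0"
      "\<And>x v. x \<in> K1 \<inter> K2 \<Longrightarrow> v \<in> N x \<Longrightarrow> s2 x v = q x * s1 x v" by metis
    have const: "q x = q p" if x: "x \<in> K1 \<inter> K2" for x
    proof (rule connected_local_const[OF K(3) x p], rule ballI)
      fix x assume x: "x \<in> K1 \<inter> K2"
      \<comment> \<open>The ratio is read off at a vertex of \<open>N x\<close>, which still belongs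
        to \<open>N y\<close> for nearby \<open>y\<close>.\<close>
      obtain v where v: "v \<in> N x" using N[OF x] bicolored_cell_nonempty by blast
      have ev1: "\<forall>\<^sub>F y in at x within K1. N x \<subseteq> N y \<and> (\<forall>v\<in>N x. s1 y v = s1 x v)"
        and ev2: "\<forall>\<^sub>F y in at x within K2. N x \<subseteq> N y \<and> (\<forall>v\<in>N x. s2 y v = s2 x v)"
        using s1 s2 x by (auto simp: flat_section_def)
      note ev = eventually_at_within_mono[OF ev1 Int_lower1]
        eventually_at_within_mono[OF ev2 Int_lower2]
      have nz: "s1 x v \<noteq> 0" using s1 x v by (auto simp: flat_section_def flat_on_def)
      from ev eventually_mem_at_within show "\<forall>\<^sub>F y in at x within K1 \<inter> K2. q x = q y"
      proof eventually_elim
        case (elim y)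
        then have "v \<in> N y" "s1 y v = s1 x v" "s2 y v = s2 x v" using v by auto
        then have "q y * s1 x v = q x * s1 x v"
          using q(2)[OF x v] q(2)[OF elim(3), of v] by simp
        with nz show ?case by simp
      qed
    qed
    show ?thesis
    proof (rule that[of "q p"])
      show "q p \<noteq> 0" using q(1) p .
      show "s2 x v = q p * s1 x v" if "x \<in> K1 \<inter> K2" "v \<in> N x" for x v
        using q(2)[OF that] const[OF that(1)] by simp
    qed
  qed
  let ?t = "\<lambda>x v. a * s1 x v"
  \<comment> \<open>On the overlap the two sections need not agree as functions, only at the
    vertices in \<open>N x\<close>; this is why \<open>in2\<close> is restricted to them.\<close>
  define s where "s x = (if x \<in> K1 then ?t x else s2 x)" for x
  have t: "flat_section m B W N K1 ?t" using s1 a(1) by (rule flat_section_scale)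
  have in1: "s x v = ?t x v" if "x \<in> K1" for x v using that by (simp add: s_def)
  have in2: "s x v = s2 x v" if "x \<in> K2" "v \<in> N x" for x v using that a by (auto simp: s_def)
  have "flat_section m B W N (K1 \<union> K2) s"
    unfolding flat_section_def
  proof (intro ballI conjI)
    fix x assume x: "x \<in> K1 \<union> K2"
    show "flat_on m B W (N x) (s x)"
      using x t s2 by (auto simp: s_def flat_section_def)
    have "\<forall>\<^sub>F y in at x within K1. N x \<subseteq> N y \<and> (\<forall>v\<in>N x. s y v = s x v)"
    proof (cases "x \<in> K1")
      case True
      then have "\<forall>\<^sub>F y in at x within K1. N x \<subseteq> N y \<and> (\<forall>v\<in>N x. ?t y v = ?t x v)"
        using t by (auto simp: flat_section_def)
      with eventually_mem_at_within show ?thesis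
        by eventually_elim (use True in1 in auto)
    qed (simp add: K eventually_at_within_closed)
    moreover have "\<forall>\<^sub>F y in at x within K2. N x \<subseteq> N y \<and> (\<forall>v\<in>N x. s y v = s x v)"
    proof (cases "x \<in> K2")
      case True
      then have "\<forall>\<^sub>F y in at x within K2. N x \<subseteq> N y \<and> (\<forall>v\<in>N x. s2 y v = s2 x v)"
        using s2 by (auto simp: flat_section_def)
      with eventually_mem_at_within show ?thesis
        by eventually_elim (use True in2 in auto)
    qed (simp add: K eventually_at_within_closed)
    ultimately show "\<forall>\<^sub>F y in at x within K1 \<union> K2. N x \<subseteq> N y \<and> (\<forall>v\<in>N x. s y v = s x v)"
      by (simp add: at_within_union eventually_sup)
  qed
  then show ?thesis by blast
qed

text \<open>Since all vertex sets contain \<open>A\<close>, every local potential can be normalized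
  to equal one fixed potential \<open>g\<close> on \<open>A\<close>. The normalized choices fit
  together: two of them differ by a left factor on the smaller vertex set, and comparison at
  \<open>v0\<close> shows that the factor is 1.\<close>

lemma flat_section_local:
  assumes N: "\<And>y. y \<in> K \<Longrightarrow> A \<subseteq> N y" "\<And>y. y \<in> K \<Longrightarrow> bicolored_cell B W (N y)"
    and A: "v0 \<in> A" "bicolored_cell B W A"
    and nbhd: "\<And>y. y \<in> K \<Longrightarrow> \<forall>\<^sub>F z in at y within K. N y \<subseteq> N z"
    and ex: "\<And>y. y \<in> K \<Longrightarrow> \<exists>g. flat_on m B W (N y) g"
  shows "\<exists>s. flat_section m B W N K s"
proof (cases "K = {}")
  case False
  then obtain x where "x \<in> K" by blast
  then obtain g where g: "flat_on m B W A g" using ex N(1) flat_on_subset by metis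
  have "\<exists>f. flat_on m B W (N y) f \<and> (\<forall>v\<in>A. f v = g v)" if y: "y \<in> K" for y
  proof -
    obtain f where f: "flat_on m B W (N y) f" using ex y by blast
    obtain a where "a \<noteq> 0" "\<And>v. v \<in> A \<Longrightarrow> g v = a * f v"
      using flat_on_unique[OF A(2) flat_on_subset[OF f N(1)[OF y]] g] by metis
    then show ?thesis using flat_on_scale[OF f] by (intro exI[of _ "\<lambda>v. a * f v"]) auto
  qed
  then obtain s where s: "\<And>y. y \<in> K \<Longrightarrow> flat_on m B W (N y) (s y)"
    "\<And>y v. y \<in> K \<Longrightarrow> v \<in> A \<Longrightarrow> s y v = g v" by metis
  have "flat_section m B W N K s"
    unfolding flat_section_def
  proof (intro ballI conjI)
    fix y assume y: "y \<in> K"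
    from nbhd[OF y] eventually_mem_at_within
    show "\<forall>\<^sub>F z in at y within K. N y \<subseteq> N z \<and> (\<forall>v\<in>N y. s z v = s y v)"
    proof eventually_elim
      case (elim z)
      have "flat_on m B W (N y) (s z)" using s(1)[of z] elim flat_on_subset by metis
      then obtain a where a: "\<And>v. v \<in> N y \<Longrightarrow> s z v = a * s y v"
        using flat_on_unique[OF N(2)[OF y] s(1)[OF y]] by metis
      have "v0 \<in> N y" "g v0 \<noteq> 0" using A g y N by (auto simp: flat_on_def)
      then have "a = 1" using a[of v0] s(2)[of y v0] s(2)[of z v0] A elim y by simp
      then show ?case using a elim by simp
    qed
  qed (use s in auto)
  then show ?thesis by blast
qed (simp add: flat_section_def)

text \<open>A rectangle is simply connected: sections over small rectangles are glued along common
  sides, first in the vertical and then in the horizontal direction.\<close>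

lemma flat_section_rectangle:
  fixes N :: "real \<times> real \<Rightarrow> 'v set" and a b c d :: real
  defines "R \<equiv> {a..b} \<times> {c..d}"
  assumes cell: "\<And>x. x \<in> R \<Longrightarrow> bicolored_cell B W (N x)"
    and nbhd: "\<And>x. x \<in> R \<Longrightarrow> \<forall>\<^sub>F y in at x within R. N x \<subseteq> N y"
    and ex: "\<And>x. x \<in> R \<Longrightarrow> \<exists>g. flat_on m B W (N x) g"
  shows "\<exists>s. flat_section m B W N R s"
proof -
  define P where "P K \<longleftrightarrow> (\<exists>s. flat_section m B W N K s)" for K
  have "\<exists>U. open U \<and> x \<in> U \<and> (\<forall>y\<in>U \<inter> R. N x \<subseteq> N y)" if x: "x \<in> R" for x
  proof -
    obtain S where "open S" "x \<in> S" "\<And>y. y \<in> S \<Longrightarrow> y \<noteq> x \<Longrightarrow> y \<in> R \<Longrightarrow> N x \<subseteq> N y"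
      using nbhd[OF x] unfolding eventually_at_topological by metis
    then show ?thesis by (intro exI[of _ S]) (metis IntD1 IntD2 order_refl)
  qed
  then obtain U where U: "\<And>x. x \<in> R \<Longrightarrow> open (U x)" "\<And>x. x \<in> R \<Longrightarrow> x \<in> U x"
    "\<And>x y. x \<in> R \<Longrightarrow> y \<in> U x \<Longrightarrow> y \<in> R \<Longrightarrow> N x \<subseteq> N y" by (metis IntI)
  have "compact R" unfolding R_def by (intro compact_Times) auto
  moreover have "R \<subseteq> \<Union>(U ` R)" using U(2) by blast
  moreover have "open G" if "G \<in> U ` R" for G using U(1) that by blast
  \<comment> \<open>A Lebesgue number of the cover: on each ball of radius \<open>\<epsilon>\<close>
    about a point of \<open>R\<close> some fixed \<open>N x\<close> is contained in all vertex sets,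
    as \<open>flat_section_local\<close> requires.\<close>
  ultimately have "\<exists>\<epsilon>>0. \<forall>x\<in>R. \<exists>G\<in>U ` R. ball x \<epsilon> \<subseteq> G"
    using Heine_Borel_lemma[of R "U ` R"] by metis
  then obtain \<epsilon> where \<epsilon>: "\<epsilon> > 0" "\<And>x. x \<in> R \<Longrightarrow> \<exists>G\<in>U ` R. ball x \<epsilon> \<subseteq> G" by blast
  have small: "P K" if K: "K \<subseteq> R" "K \<subseteq> ball z \<epsilon>" "z \<in> R" for K z
  proof -
    obtain x where x: "x \<in> R" "ball z \<epsilon> \<subseteq> U x" using \<epsilon>(2)[OF K(3)] by blast
    obtain v where v: "v \<in> N x" using cell[OF x(1)] bicolored_cell_nonempty by blast
    have "\<forall>\<^sub>F z in at y within K. N y \<subseteq> N z" if "y \<in> K" for y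
      using eventually_at_within_mono[OF nbhd K(1)] that K(1) by blast
    moreover have "N x \<subseteq> N y" if "y \<in> K" for y using U(3)[OF x(1)] that K x by blast
    ultimately show ?thesis
      unfolding P_def
      using K(1) cell ex x v by (intro flat_section_local[of K "N x" N B W v]) auto
  qed
  have glue: "P (K1 \<union> K2)"
    if K: "P K1" "P K2" "closed K1" "closed K2" "connected (K1 \<inter> K2)" "K1 \<subseteq> R" for K1 K2
  proof -
    obtain s1 s2 where "flat_section m B W N K1 s1" "flat_section m B W N K2 s2"
      using K by (auto simp: P_def)
    then show ?thesis unfolding P_def by (rule flat_section_glue) (use K cell in auto)
  qed
  have R_Int: "R \<inter> {u..v} \<times> {p..q} = ({a..b} \<inter> {u..v}) \<times> ({c..d} \<inter> {p..q})" for u v p q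
    by (auto simp: R_def)
  have box: "closed (R \<inter> {u..v} \<times> {p..q})" "connected (R \<inter> {u..v} \<times> {p..q})" for u v p q
    unfolding R_Int by (auto intro!: closed_Times convex_connected convex_Times convex_Int)
  \<comment> \<open>If both sides of a box around \<open>(x, y)\<close> are shorter than
    \<open>\<epsilon> / 2\<close>, the box lies in the ball of radius \<open>\<epsilon>\<close>,
    since the distance is at most the sum of the coordinate distances.\<close>
  have strip: "P (R \<inter> {u..v} \<times> {c..d})"
    if x: "a \<le> x" "x \<le> b" "u \<le> x" "x \<le> v" "v - u < \<epsilon> / 2" for u v x
  proof (cases "c \<le> d")
    case True
    then show ?thesis
    proof (induction rule: Bolzano)
      \<comment> \<open>Bisection principle: the property passes to the union of adjacent intervals
        and holds for short ones. The common side is kept as a degenerate box, so that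
        \<open>box\<close> shows it to be connected.\<close>
      case (trans p q r)
      have "R \<inter> {u..v} \<times> {p..q} \<inter> (R \<inter> {u..v} \<times> {q..r}) = R \<inter> {u..v} \<times> {q..q}"
        using trans by auto
      then have "P (R \<inter> {u..v} \<times> {p..q} \<union> R \<inter> {u..v} \<times> {q..r})"
        using trans box by (intro glue) (auto simp del: atLeastAtMost_singleton)
      moreover have "R \<inter> {u..v} \<times> {p..q} \<union> R \<inter> {u..v} \<times> {q..r} = R \<inter> {u..v} \<times> {p..r}"
        using trans by auto
      ultimately show ?case by simp
    next
      case (local y)
      have "P (R \<inter> {u..v} \<times> {p..q})" if y: "p \<le> y" "y \<le> q" "q - p < \<epsilon> / 2" for p q
      proof (rule small[of _ "(x, y)"])
        show "R \<inter> {u..v} \<times> {p..q} \<subseteq> ball (x, y) \<epsilon>"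
        proof clarify
          fix s t assume st: "s \<in> {u..v}" "t \<in> {p..q}"
          have "dist (x, y) (s, t) \<le> dist x s + dist y t"
            by (simp add: dist_Pair_Pair sqrt_sum_squares_le_sum)
          also have "\<dots> < \<epsilon>" using st x y by (simp add: dist_real_def abs_if)
          finally show "(s, t) \<in> ball (x, y) \<epsilon>" by simp
        qed
      qed (use x local in \<open>auto simp: R_def\<close>)
      then show ?case using \<epsilon>(1) by (intro exI[of _ "\<epsilon> / 2"]) auto
    qed
  qed (simp add: P_def flat_section_def)
  have "P (R \<inter> {a..b} \<times> {c..d})"
  proof (cases "a \<le> b")
    case True
    then show ?thesis
    proof (induction rule: Bolzano)
      case (trans p q r)
      have "R \<inter> {p..q} \<times> {c..d} \<inter> (R \<inter> {q..r} \<times> {c..d}) = R \<inter> {q..q} \<times> {c..d}"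
        using trans by auto
      then have "P (R \<inter> {p..q} \<times> {c..d} \<union> R \<inter> {q..r} \<times> {c..d})"
        using trans box by (intro glue) (auto simp del: atLeastAtMost_singleton)
      moreover have "R \<inter> {p..q} \<times> {c..d} \<union> R \<inter> {q..r} \<times> {c..d} = R \<inter> {p..r} \<times> {c..d}"
        using trans by auto
      ultimately show ?case by simp
    next
      case (local x)
      then show ?case using strip[OF local] \<epsilon>(1) by (intro exI[of _ "\<epsilon> / 2"]) auto
    qed
  qed (simp add: P_def flat_section_def)
  then show ?thesis unfolding P_def R_def by simp
qed

text \<open>Normalize \<open>g b1 = 1\<close>. Three of the four relations then determine
  \<open>g\<close> at the other corners, and the fourth, between \<open>b2\<close> and
  \<open>w2\<close>, is the displayed equation.\<close>

lemma flat_on_quadrilateral: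
  fixes m :: "'v \<Rightarrow> 'v \<Rightarrow> 'd::division_ring"
  assumes B: "B \<inter> A = {b1, b2}" and W: "W \<inter> A = {w1, w2}" and A: "A \<subseteq> B \<union> W" "B \<inter> W = {}"
    and nz: "\<And>b w. b \<in> {b1, b2} \<Longrightarrow> w \<in> {w1, w2} \<Longrightarrow> m b w \<noteq> 0"
  shows "(\<exists>g. flat_on m B W A g) \<longleftrightarrow>
    inverse (m b1 w1) * m b1 w2 = inverse (m b2 w1) * m b2 w2"
proof
  assume "\<exists>g. flat_on m B W A g"
  then obtain g where g: "flat_on m B W A g" by blast
  have "inverse (m b w1) * m b w2 = inverse (g w1) * g w2" if b: "b \<in> {b1, b2}" for b
  proof -
    have "b \<in> B \<inter> A" "w1 \<in> W \<inter> A" "w2 \<in> W \<inter> A" using b B W by auto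
    then have "g w1 = g b * m b w1" "g w2 = g b * m b w2" "g b \<noteq> 0"
      using g by (auto simp: flat_on_def)
    moreover have "inverse (g b) * (g b * m b w2) = m b w2"
      using \<open>g b \<noteq> 0\<close> by (simp flip: mult.assoc)
    ultimately show ?thesis using nz[OF b] by (simp add: nonzero_inverse_mult_distrib mult.assoc)
  qed
  then show "inverse (m b1 w1) * m b1 w2 = inverse (m b2 w1) * m b2 w2" by simp
next
  assume eq: "inverse (m b1 w1) * m b1 w2 = inverse (m b2 w1) * m b2 w2"
  define g where "g v = (if v \<in> W then m b1 v else m b1 w1 * inverse (m v w1))" for v
  have b: "b1 \<in> B \<inter> A" "b2 \<in> B \<inter> A" "b1 \<notin> W" "b2 \<notin> W" using B A by auto
  have w: "w1 \<in> W" "w2 \<in> W" using W by auto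
  have "m b1 w2 = m b1 w1 * (inverse (m b1 w1) * m b1 w2)"
    using nz[of b1 w1] by (simp flip: mult.assoc)
  also have "\<dots> = m b1 w1 * inverse (m b2 w1) * m b2 w2" unfolding eq by (simp add: mult.assoc)
  finally have b2w2: "m b1 w2 = m b1 w1 * inverse (m b2 w1) * m b2 w2" .
  have "g w = g b * m b w" if "b \<in> {b1, b2}" "w \<in> {w1, w2}" for b w
  proof -
    have "g w1 = m b1 w1" "g w2 = m b1 w2" "g b1 = 1" "g b2 = m b1 w1 * inverse (m b2 w1)"
      using b w nz[of b1 w1] by (simp_all add: g_def)
    moreover have "m b1 w1 * inverse (m b2 w1) * m b2 w1 = m b1 w1"
      using nz[of b2 w1] by (simp add: mult.assoc)
    ultimately show ?thesis using that b2w2 by (elim insertE emptyE) simp_all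
  qed
  moreover have "g v \<noteq> 0" if "v \<in> A" for v
  proof -
    have "v \<in> B \<inter> A \<union> W \<inter> A" using that A(1) by blast
    then have "v \<in> {b1, b2} \<or> v \<in> {w1, w2}" unfolding B W by blast
    then show ?thesis
    proof
      assume v: "v \<in> {b1, b2}"
      then have "v \<notin> W" using b by blast
      then show ?thesis using nz[OF v, of w1] nz[of b1 w1] by (simp add: g_def)
    next
      assume v: "v \<in> {w1, w2}"
      then have "v \<in> W" using w by blast
      then show ?thesis using nz[OF _ v, of b1] by (simp add: g_def)
    qed
  qed
  ultimately show "\<exists>g. flat_on m B W A g" using B W by (intro exI[of _ g]) (simp add: flat_on_def)
qed

section \<open>Tilings\<close>

text \<open>The arcs include their initial point, so that every boundary point of a tile is caught
  either as a corner or on an open side.\<close>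

lemma unit_circle_quarters:
  assumes "z \<in> sphere 0 1"
  obtains j t where "j < (4::nat)" "z = cis t"
    "t \<in> {2 * pi * real j / real 4..<2 * pi * real (j + 1) / real 4}"
proof -
  define t where "t = Arg2pi z"
  have z: "z = cis t" using assms Arg2pi_eq[of z] by (simp add: cis_conv_exp t_def)
  have t: "0 \<le> t" "t < 2 * pi" using Arg2pi[of z] by (auto simp: t_def)
  then consider "t \<in> {0..<pi / 2}" | "t \<in> {pi / 2..<pi}" | "t \<in> {pi..<3 * pi / 2}"
    | "t \<in> {3 * pi / 2..<2 * pi}" by fastforce
  then show ?thesis
  proof cases
    case 1 then show ?thesis using z by (intro that[of 0 t]) auto
  next
    case 2 then show ?thesis using z by (intro that[of 1 t]) auto
  next
    case 3 then show ?thesis using z by (intro that[of 2 t]) auto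
  next
    case 4 then show ?thesis using z by (intro that[of 3 t]) auto
  qed
qed

lemma fourth_roots:
  "cis (2 * pi * real 0 / real 4) = 1" "cis (2 * pi * real 1 / real 4) = \<i>"
  "cis (2 * pi * real 2 / real 4) = - 1" "cis (2 * pi * real 3 / real 4) = - \<i>"
  "cis (2 * pi * real 4 / real 4) = 1"
proof -
  have "cis (2 * pi * 3 / 4) = cis pi * cis (pi / 2)" unfolding cis_mult by (rule arg_cong) simp
  then show "cis (2 * pi * real 3 / real 4) = - \<i>" by simp
qed simp_all

section \<open>Edges and tile boundaries with their coloring\<close>

locale quad_tiling =
  fixes X V :: "'a::t2_space set" and E F B W
  assumes tiling: "quadrilateral_tiling X V E F B W"
begin

lemma decomposition:
  "finite V" "finite E" "finite F" "V \<union> \<Union>E \<union> \<Union>F = X"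
  "V \<inter> \<Union>E = {}" "V \<inter> \<Union>F = {}" "\<Union>E \<inter> \<Union>F = {}" "pairwise disjnt E" "pairwise disjnt F"
  using tiling
  by (auto simp: quadrilateral_tiling_def polygonal_subdivision_def cellular_decomposition_def)

lemma colors: "V = B \<union> W" "B \<inter> W = {}"
  using tiling by (auto simp: quadrilateral_tiling_def)

lemma edge_colors:
  assumes "e \<in> E"
  obtains b w where "b \<in> B" "w \<in> W" "b \<noteq> w" "cell_vertices V e = {b, w}"
  using tiling assms colors unfolding quadrilateral_tiling_def by blast

text \<open>The image of the closed interval is compact, hence closed, so the closure adds only the
  two end values to \<open>e\<close>; the open edge itself contains no vertex.\<close>

lemma edge_path:
  assumes e: "e \<in> E"
  obtains \<gamma> where "continuous_on {0..1::real} \<gamma>" "\<gamma> ` {0<..<1} = e" "closure e = \<gamma> ` {0..1}"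
    "cell_vertices V e = {\<gamma> 0, \<gamma> 1}"
proof -
  obtain \<gamma> \<gamma>' where \<gamma>: "continuous_on {0..1::real} \<gamma>" "homeomorphism {0<..<1} e \<gamma> \<gamma>'"
    "\<gamma> 0 \<in> V" "\<gamma> 1 \<in> V"
    using tiling e
    by (fastforce simp: quadrilateral_tiling_def polygonal_subdivision_def cellular_decomposition_def)
  have im: "\<gamma> ` {0<..<1} = e" using \<gamma>(2) by (auto simp: homeomorphism_def)
  have "compact (\<gamma> ` {0..1})" using \<gamma>(1) by (intro compact_continuous_image) auto
  then have "closure e \<subseteq> \<gamma> ` {0..1}"
    unfolding im[symmetric] by (intro closure_minimal compact_imp_closed) auto
  moreover have "\<gamma> ` closure {0<..<1} \<subseteq> closure e"
    using \<gamma>(1) by (intro image_closure_subset) (auto simp: im closure_subset)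
  ultimately have cl: "closure e = \<gamma> ` {0..1}" by auto
  have "{0..1::real} = {0<..<1} \<union> {0, 1}" by auto
  then have "closure e = e \<union> {\<gamma> 0, \<gamma> 1}" unfolding cl by (simp only: image_Un im) auto
  then have "cell_vertices V e = {\<gamma> 0, \<gamma> 1}"
    using \<gamma> decomposition(5) e by (auto simp: cell_vertices_def)
  with that \<gamma>(1) im cl show ?thesis by blast
qed

text \<open>Corners and sides in cyclic order, with \<open>c 4 = c 0\<close> closing the
  cycle.\<close>

lemma tile_boundary:
  assumes f: "f \<in> F"
  obtains c :: "nat \<Rightarrow> 'a" and s :: "nat \<Rightarrow> 'a set"
  where "\<And>j. j < 4 \<Longrightarrow> c j \<in> V" "\<And>j. j < 4 \<Longrightarrow> s j \<in> E" "c 4 = c 0" "distinct [c 0, c 1, c 2, c 3]"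
    "\<And>j. j < 4 \<Longrightarrow> cell_vertices V (s j) = {c j, c (j + 1)}"
    "closure f = f \<union> (\<Union>j<4. {c j} \<union> s j)"
proof -
  obtain \<phi> \<phi>' where \<phi>: "homeomorphism (cball (0::complex) 1) (closure f) \<phi> \<phi>'" "\<phi> ` ball 0 1 = f"
    and cor: "\<And>j. j < 4 \<Longrightarrow> \<phi> (cis (2 * pi * real j / real 4)) \<in> V"
    and side: "\<And>j. j < 4 \<Longrightarrow>
      \<phi> ` cis ` {2 * pi * real j / real 4 <..< 2 * pi * real (j + 1) / real 4} \<in> E"
    using tiling f by (fastforce simp: quadrilateral_tiling_def embedded_polygon_def)
  define c where "c j = \<phi> (cis (2 * pi * real j / real 4))" for j
  define s where "s j = \<phi> ` cis ` {2 * pi * real j / real 4 <..< 2 * pi * real (j + 1) / real 4}" for j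
  have cont: "continuous_on (cball 0 1) \<phi>" and inj: "inj_on \<phi> (cball 0 1)"
    and im: "\<phi> ` cball 0 1 = closure f"
    using \<phi>(1) by (auto simp: homeomorphism_def intro: inj_on_inverseI)
  have c_simps: "c 0 = \<phi> 1" "c 1 = \<phi> \<i>" "c 2 = \<phi> (- 1)" "c 3 = \<phi> (- \<i>)" "c 4 = \<phi> 1"
    unfolding c_def fourth_roots by (rule refl)+
  have cV: "c j \<in> V" if "j < 4" for j using cor that by (simp add: c_def)
  have sE: "s j \<in> E" if "j < 4" for j using side that by (simp add: s_def)
  have dist: "distinct [c 0, c 1, c 2, c 3]"
    unfolding c_simps using inj by (auto simp: inj_on_eq_iff complex_eq_iff)
  have c4: "c 4 = c 0" by (simp add: c_simps)
  have less4: "j = 0 \<or> j = 1 \<or> j = 2 \<or> j = 3" if "j < 4" for j :: nat using that by auto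
  have neq: "c j \<noteq> c (j + 1)" if "j < 4" for j
    using less4[OF that] dist c4 by (auto simp: numeral_eq_Suc)
  have V': "c (j + 1) \<in> V" if "j < 4" for j
    using less4[OF that] cV[of 0] cV[of 1] cV[of 2] cV[of 3] c4 by (auto simp: numeral_eq_Suc)
  have verts: "cell_vertices V (s j) = {c j, c (j + 1)}" if j: "j < 4" for j
  proof -
    let ?a = "2 * pi * real j / real 4" and ?b = "2 * pi * real (j + 1) / real 4"
    have "?a < ?b" by (simp add: field_simps)
    then have cl: "closure {?a<..<?b} = {?a..?b}" by (rule closure_greaterThanLessThan)
    have "continuous_on {?a..?b} (\<phi> \<circ> cis)"
      by (intro continuous_on_compose continuous_on_subset[OF cont] continuous_intros) auto
    then have "(\<phi> \<circ> cis) ` closure {?a<..<?b} \<subseteq> closure (s j)"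
      unfolding cl[symmetric] using closure_subset[of "s j"]
      by (intro image_closure_subset) (auto simp: s_def)
    then have "{c j, c (j + 1)} \<subseteq> closure (s j)"
      unfolding cl c_def using \<open>?a < ?b\<close> by (auto simp: image_subset_iff)
    then have "{c j, c (j + 1)} \<subseteq> cell_vertices V (s j)"
      using cV V' j by (auto simp: cell_vertices_def)
    \<comment> \<open>The coloring bounds the vertices of an edge by two, so the two distinct
      corners found in the closure are all of them.\<close>
    moreover obtain b w where "cell_vertices V (s j) = {b, w}"
      using edge_colors[OF sE[OF j]] by metis
    ultimately show ?thesis using neq[OF j] by auto
  qed
  have sph: "\<phi> ` sphere 0 1 = (\<Union>j<4. {c j} \<union> s j)"
  proof (intro equalityI subsetI)
    fix x assume "x \<in> \<phi> ` sphere 0 1"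
    then obtain z where z: "z \<in> sphere 0 1" "x = \<phi> z" by blast
    obtain j t where j: "j < (4::nat)" "z = cis t"
      "t \<in> {2 * pi * real j / real 4..<2 * pi * real (j + 1) / real 4}"
      using unit_circle_quarters[OF z(1)] by metis
    then have "x = c j \<or> x \<in> s j"
      unfolding c_def s_def z(2) by (cases "t = 2 * pi * real j / real 4") auto
    then show "x \<in> (\<Union>j<4. {c j} \<union> s j)" using j(1) by auto
  qed (auto simp: c_def s_def)
  have "cball 0 1 = ball 0 1 \<union> sphere (0::complex) 1" by auto
  then have "closure f = f \<union> (\<Union>j<4. {c j} \<union> s j)"
    unfolding im[symmetric] using \<phi>(2) sph by (simp only: image_Un)
  with that cV sE c4 dist verts show ?thesis by blast
qed

text \<open>Colors alternate along the four sides, so opposite corners share a color. In a 4-cycle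
  each corner is adjacent to both corners of the other color, which gives an edge for every black
  and white pair.\<close>

lemma tile_corners:
  assumes f: "f \<in> F"
  obtains b1 b2 w1 w2 where "b1 \<noteq> b2" "w1 \<noteq> w2"
    "cell_vertices B f = {b1, b2}" "cell_vertices W f = {w1, w2}"
    "\<And>b w. b \<in> {b1, b2} \<Longrightarrow> w \<in> {w1, w2} \<Longrightarrow> \<exists>e\<in>E. cell_vertices V e = {b, w}"
proof -
  obtain c :: "nat \<Rightarrow> 'a" and s :: "nat \<Rightarrow> 'a set"
    where c: "\<And>j. j < 4 \<Longrightarrow> c j \<in> V" "\<And>j. j < 4 \<Longrightarrow> s j \<in> E" "c 4 = c 0"
    "distinct [c 0, c 1, c 2, c 3]"
    "\<And>j. j < 4 \<Longrightarrow> cell_vertices V (s j) = {c j, c (j + 1)}"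
    "closure f = f \<union> (\<Union>j<4. {c j} \<union> s j)"
    by (rule tile_boundary[OF f]) blast
  have "{..<4::nat} = {0, 1, 2, 3}" by auto
  then have "(\<Union>j<4. {c j} \<union> s j) = {c 0, c 1, c 2, c 3} \<union> (\<Union>j<4. s j)" by auto
  then have cl: "closure f = f \<union> ({c 0, c 1, c 2, c 3} \<union> (\<Union>j<4. s j))" using c(6) by simp
  have "(\<Union>j<4. s j) \<inter> V = {}" "f \<inter> V = {}" using c(2) decomposition(5,6) f by auto
  moreover have "{c 0, c 1, c 2, c 3} \<subseteq> V" using c(1) by simp
  ultimately have V: "closure f \<inter> V = {c 0, c 1, c 2, c 3}" unfolding cl by blast
  have e: "cell_vertices V (s 0) = {c 0, c 1}" "cell_vertices V (s 1) = {c 1, c 2}"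
    "cell_vertices V (s 2) = {c 2, c 3}" "cell_vertices V (s 3) = {c 3, c 0}"
    "s 0 \<in> E" "s 1 \<in> E" "s 2 \<in> E" "s 3 \<in> E"
    using c(5)[of 0] c(5)[of 1] c(5)[of 2] c(5)[of 3] c(2,3) by (auto simp: numeral_eq_Suc)
  have alt: "x \<in> B \<and> y \<in> W \<or> x \<in> W \<and> y \<in> B" if "e \<in> E" "cell_vertices V e = {x, y}" for e x y
  proof -
    obtain b w where "b \<in> B" "w \<in> W" "cell_vertices V e = {b, w}"
      using edge_colors[OF \<open>e \<in> E\<close>] by metis
    then show ?thesis using that(2) by (auto simp: doubleton_eq_iff)
  qed
  note alts = alt[OF e(5,1)] alt[OF e(6,2)] alt[OF e(7,3)] alt[OF e(8,4)]
  have comm: "\<exists>e\<in>E. cell_vertices V e = {y, x}" if "\<exists>e\<in>E. cell_vertices V e = {x, y}" for x y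
    using that by (simp add: insert_commute)
  have ex: "\<exists>e\<in>E. cell_vertices V e = {x, y}"
    if "x \<in> {c 0, c 2}" "y \<in> {c 1, c 3}" for x y
    using that e by (auto simp: insert_commute)
  have sub: "cell_vertices B f = (closure f \<inter> V) \<inter> B" "cell_vertices W f = (closure f \<inter> V) \<inter> W"
    using colors by (auto simp: cell_vertices_def)
  show ?thesis
  proof (cases "c 0 \<in> B")
    case True
    then have "c 1 \<in> W" "c 2 \<in> B" "c 3 \<in> W" using alts colors(2) by blast+
    then show ?thesis
      using True c(4) colors(2) ex by (intro that[of "c 0" "c 2" "c 1" "c 3"]) (auto simp: sub V)
  next
    case False
    then have "c 0 \<in> W" "c 1 \<in> B" "c 2 \<in> W" "c 3 \<in> B" using alts colors(2) by blast+
    then show ?thesis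
      using c(4) colors(2) comm[OF ex] by (intro that[of "c 1" "c 3" "c 0" "c 2"]) (auto simp: sub V)
  qed
qed

section \<open>The cell containing a point, and its vertices\<close>

definition cells :: "'a set set" where
  "cells = (\<lambda>v. {v}) ` V \<union> E \<union> F"

lemma cells_cover: "\<Union>cells = X"
  using decomposition(4) by (auto simp: cells_def)

lemma finite_cells: "finite cells"
  using decomposition by (simp add: cells_def)

lemma cells_disjoint:
  assumes "c \<in> cells" "c' \<in> cells" "x \<in> c" "x \<in> c'"
  shows "c = c'"
  using assms decomposition(5-7) pairwiseD[OF decomposition(8), of c c'] 
    pairwiseD[OF decomposition(9), of c c']
  by (auto simp: cells_def disjnt_iff)

text \<open>Closed cells are unions of cells, and the boundary of a cell consists of vertices and
  edges. The last disjunct records the second fact, so that no other closed cell reaches into an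
  open tile.\<close>

lemma closure_cell:
  assumes c: "c \<in> cells" "x \<in> closure c"
  shows "\<exists>d\<in>cells. x \<in> d \<and> d \<subseteq> closure c \<and> (d = c \<or> d \<notin> F)"
proof -
  have vertex: ?thesis if v: "x \<in> V"
    using v c decomposition(6) by (intro bexI[of _ "{x}"]) (auto simp: cells_def)
  have self: ?thesis if xc: "x \<in> c"
    using xc c closure_subset[of c] by (intro bexI[of _ c]) auto
  consider v where "v \<in> V" "c = {v}" | "c \<in> E" | "c \<in> F"
    using c by (auto simp: cells_def)
  then show ?thesis
  proof cases
    case 1
    then show ?thesis using c self by auto
  next
    case 2
    obtain \<gamma> where \<gamma>: "\<gamma> ` {0<..<1::real} = c" "closure c = \<gamma> ` {0..1}"
      "cell_vertices V c = {\<gamma> 0, \<gamma> 1}"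
      using edge_path[OF 2] by metis
    have "\<gamma> 0 \<in> V" "\<gamma> 1 \<in> V" using \<gamma>(3) by (auto simp: cell_vertices_def)
    moreover obtain t where t: "t \<in> {0..1}" "x = \<gamma> t" using c(2) \<gamma>(2) by auto
    moreover have "x \<in> c" if "t \<noteq> 0" "t \<noteq> 1"
      using t that unfolding \<gamma>(1)[symmetric] by (intro image_eqI[of _ _ t]) auto
    ultimately show ?thesis using vertex self by metis
  next
    case 3
    obtain k :: "nat \<Rightarrow> 'a" and s :: "nat \<Rightarrow> 'a set"
      where k: "\<And>j. j < 4 \<Longrightarrow> k j \<in> V" "\<And>j. j < 4 \<Longrightarrow> s j \<in> E"
        and "k 4 = k 0" "distinct [k 0, k 1, k 2, k 3]"
        "\<And>j. j < 4 \<Longrightarrow> cell_vertices V (s j) = {k j, k (j + 1)}"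
        and cl: "closure c = c \<union> (\<Union>j<4. {k j} \<union> s j)"
      by (rule tile_boundary[OF 3]) blast
    consider "x \<in> c" | j where "j < 4" "x = k j" | j where "j < 4" "x \<in> s j"
      using c(2) cl by auto
    then show ?thesis
    proof cases
      case (3 j)
      \<comment> \<open>An open side is nonempty and disjoint from all faces as a point set, so it
        is not itself a member of \<open>F\<close>.\<close>
      have "s j \<noteq> {}" "s j \<inter> \<Union>F = {}" using 3 k(2)[OF 3(1)] decomposition(7) by auto
      then show ?thesis using 3 k cl by (intro bexI[of _ "s j"]) (auto simp: cells_def)
    qed (use vertex self k in auto)
  qed
qed

lemma cell_subset_closure:
  assumes c: "c \<in> cells" "c' \<in> cells" "x \<in> c" "x \<in> closure c'"
  shows "c \<subseteq> closure c'"
  using closure_cell[OF c(2,4)] cells_disjoint[OF c(1) _ c(3)] by metis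

text \<open>The vertices over which the local potentials at \<open>x\<close> are defined. The
  existential ranges over just one cell when \<open>x\<close> lies in \<open>X\<close>, because the
  cells are disjoint.\<close>

definition carrier_vertices :: "'a \<Rightarrow> 'a set" where
  "carrier_vertices x = {v \<in> V. \<exists>c\<in>cells. x \<in> c \<and> v \<in> closure c}"

lemma carrier_vertices_eq:
  "c \<in> cells \<Longrightarrow> x \<in> c \<Longrightarrow> carrier_vertices x = cell_vertices V c"
  unfolding carrier_vertices_def cell_vertices_def using cells_disjoint by blast

text \<open>Remove the finitely many closed cells that miss \<open>x\<close>. The cell of any
  remaining point has \<open>x\<close> in its closure, hence contains the whole cell of
  \<open>x\<close>, and its vertices, in its closure.\<close>

lemma carrier_vertices_nbhd:
  assumes "x \<in> X"
  obtains U where "open U" "x \<in> U" "\<And>y. y \<in> U \<Longrightarrow> y \<in> X \<Longrightarrow> carrier_vertices x \<subseteq> carrier_vertices y"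
proof -
  define D where "D = {c \<in> cells. x \<notin> closure c}"
  obtain c where c: "c \<in> cells" "x \<in> c" using assms cells_cover by blast
  show ?thesis
  proof (rule that[of "- (\<Union>d\<in>D. closure d)"])
    have "finite D" using finite_cells by (simp add: D_def)
    then have "closed (\<Union>d\<in>D. closure d)" by (intro closed_UN) auto
    then show "open (- (\<Union>d\<in>D. closure d))" by (rule open_Compl)
    show "x \<in> - (\<Union>d\<in>D. closure d)" by (auto simp: D_def)
    fix y assume y: "y \<in> - (\<Union>d\<in>D. closure d)" "y \<in> X"
    obtain d where d: "d \<in> cells" "y \<in> d" using y cells_cover by blast
    then have "x \<in> closure d" using y closure_subset[of d] by (auto simp: D_def)
    then have "c \<subseteq> closure d" using cell_subset_closure c d by blast
    then have "closure c \<subseteq> closure d" by (simp add: closure_minimal)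
    then show "carrier_vertices x \<subseteq> carrier_vertices y"
      using c d by (auto simp: carrier_vertices_eq cell_vertices_def)
  qed
qed

lemma bicolored_cell_vertices:
  assumes "c \<in> cells"
  shows "bicolored_cell B W (cell_vertices V c)"
proof -
  consider v where "v \<in> V" "c = {v}" | "c \<in> E" | "c \<in> F"
    using assms by (auto simp: cells_def)
  then show ?thesis
  proof cases
    case 1
    then show ?thesis using colors by (auto simp: bicolored_cell_def cell_vertices_def)
  next
    case 2
    then obtain b w where "b \<in> B" "w \<in> W" "cell_vertices V c = {b, w}"
      using edge_colors by metis
    then show ?thesis by (auto simp: bicolored_cell_def)
  next
    case 3
    then obtain b1 b2 w1 w2 where "cell_vertices B c = {b1, b2}" "cell_vertices W c = {w1, w2}"
      using tile_corners by metis
    then have "b1 \<in> cell_vertices V c \<inter> B" "w1 \<in> cell_vertices V c \<inter> W"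
      using colors by (auto simp: cell_vertices_def)
    then show ?thesis using colors by (auto simp: bicolored_cell_def cell_vertices_def)
  qed
qed

text \<open>The complement is the finite union of the closures of the other cells, none of which
  meets \<open>f\<close>.\<close>

lemma closed_diff_tile:
  assumes f: "f \<in> F"
  shows "closed (X - f)"
proof -
  have "X - f = (\<Union>c\<in>cells - {f}. closure c)"
  proof (intro equalityI subsetI)
    fix x assume "x \<in> X - f"
    then obtain c where "c \<in> cells" "x \<in> c" "c \<noteq> f" using cells_cover by blast
    then show "x \<in> (\<Union>c\<in>cells - {f}. closure c)" using closure_subset[of c] by blast
  next
    fix x assume "x \<in> (\<Union>c\<in>cells - {f}. closure c)"
    then obtain c where c: "c \<in> cells" "c \<noteq> f" "x \<in> closure c" by blast
    obtain d where d: "d \<in> cells" "x \<in> d" "d = c \<or> d \<notin> F"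
      using closure_cell[OF c(1,3)] by metis
    then have "d \<noteq> f" using c f by auto
    then have "x \<notin> f" using cells_disjoint[of d f x] d f by (auto simp: cells_def)
    then show "x \<in> X - f" using d cells_cover by blast
  qed
  moreover have "closed (\<Union>c\<in>cells - {f}. closure c)"
    using finite_cells by (intro closed_UN) auto
  ultimately show ?thesis by simp
qed

text \<open>Along an open edge a section is constant and agrees with its values at the two ends, so
  evaluating the section at each vertex gives a potential for \<open>m\<close> on every edge.\<close>

lemma flat_on_edges:
  fixes m :: "'a \<Rightarrow> 'a \<Rightarrow> 'd::division_ring"
    and h :: "real \<times> real \<Rightarrow> 'a"
  assumes f0: "f0 \<in> F"
    and X: "compact X"
    and h: "continuous_on UNIV h" "range h \<subseteq> X - f0"
    and \<psi>: "continuous_on (X - f0) \<psi>" "\<And>x. x \<in> X - f0 \<Longrightarrow> h (\<psi> x) = x"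
    and edges: "\<And>e b w. e \<in> E \<Longrightarrow> b \<in> B \<Longrightarrow> w \<in> W \<Longrightarrow> cell_vertices V e = {b, w} \<Longrightarrow> m b w \<noteq> 0"
    and faces: "\<And>f. f \<in> F - {f0} \<Longrightarrow> \<exists>g. flat_on m B W (cell_vertices V f) g"
  obtains g where "\<And>e. e \<in> E \<Longrightarrow> flat_on m B W (cell_vertices V e) g"
proof -
  have ex: "\<exists>g. flat_on m B W (cell_vertices V c) g" if c: "c \<in> cells - {f0}" for c
  proof -
    consider v where "v \<in> V" "c = {v}" | "c \<in> E" | "c \<in> F - {f0}"
      using c by (auto simp: cells_def)
    then show ?thesis
    proof cases
      case 1
      then show ?thesis using colors(2)
        by (intro exI[of _ "\<lambda>_. 1"]) (auto simp: flat_on_def cell_vertices_def)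
    next
      case 2
      obtain b w where bw: "b \<in> B" "w \<in> W" "b \<noteq> w" "cell_vertices V c = {b, w}"
        using edge_colors[OF 2] by metis
      then have "b \<notin> W" "w \<notin> B" "m b w \<noteq> 0" using colors(2) edges 2 by auto
      with bw show ?thesis
        by (intro exI[of _ "\<lambda>v. if v = b then 1 else m b w"]) (auto simp: flat_on_def)
    next
      case 3
      then show ?thesis using faces by blast
    qed
  qed
  define N where "N = carrier_vertices \<circ> h"
  have carrier: "\<exists>c\<in>cells - {f0}. x \<in> c \<and> carrier_vertices x = cell_vertices V c"
    if "x \<in> X - f0" for x
    using that cells_cover carrier_vertices_eq by blast
  have hX: "h p \<in> X - f0" for p using h(2) by blast
  have "X \<inter> (X - f0) = X - f0" by blast
  then have "compact (X - f0)" using compact_Int_closed[OF X closed_diff_tile[OF f0]] by simp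
  then have "bounded (\<psi> ` (X - f0))"
    using \<psi>(1) by (intro compact_imp_bounded compact_continuous_image)
  then obtain r where r: "\<And>x. x \<in> \<psi> ` (X - f0) \<Longrightarrow> norm x \<le> r"
    unfolding bounded_iff by blast
  \<comment> \<open>The square must contain the image of \<open>\<psi>\<close>, because the section
    is evaluated at the points \<open>\<psi> v\<close> and along the images of edges; compactness
    bounds this image.\<close>
  define R where "R = {-r..r} \<times> {-r..r}"
  have R: "\<psi> ` (X - f0) \<subseteq> R"
  proof
    fix p assume p: "p \<in> \<psi> ` (X - f0)"
    have "\<bar>fst p\<bar> \<le> norm p" "\<bar>snd p\<bar> \<le> norm p"
      using norm_fst_le[of "fst p" "snd p"] norm_snd_le[of "snd p" "fst p"] by auto
    with r[OF p] show "p \<in> R" by (auto simp: R_def mem_Times_iff)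
  qed
  have "\<exists>s. flat_section m B W N R s"
    unfolding R_def
  proof (rule flat_section_rectangle)
    fix p
    obtain c where c: "c \<in> cells - {f0}" "h p \<in> c" "carrier_vertices (h p) = cell_vertices V c"
      using carrier[OF hX] by metis
    show "bicolored_cell B W (N p)" using c bicolored_cell_vertices by (simp add: N_def)
    show "\<exists>g. flat_on m B W (N p) g" using c ex by (simp add: N_def)
    obtain U where U: "open U" "h p \<in> U"
      "\<And>y. y \<in> U \<Longrightarrow> y \<in> X \<Longrightarrow> carrier_vertices (h p) \<subseteq> carrier_vertices y"
      using carrier_vertices_nbhd[of "h p"] hX by (metis DiffD1)
    have "open (h -` U)" using h(1) U(1) by (simp add: continuous_on_open_vimage)
    moreover have "N p \<subseteq> N q" if "q \<in> h -` U" for q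
      using U(3)[of "h q"] hX[of q] that by (simp add: N_def)
    ultimately show "\<forall>\<^sub>F q in at p within {-r..r} \<times> {-r..r}. N p \<subseteq> N q"
      using U(2) unfolding eventually_at_topological by (intro exI[of _ "h -` U"]) auto
  qed
  then obtain s where s: "flat_section m B W N R s" by blast
  show ?thesis
  proof (rule that[of "\<lambda>v. s (\<psi> v) v"])
    fix e assume e: "e \<in> E"
    obtain \<gamma> where \<gamma>: "continuous_on {0..1::real} \<gamma>" "\<gamma> ` {0<..<1} = e"
      "cell_vertices V e = {\<gamma> 0, \<gamma> 1}"
      using edge_path[OF e] by metis
    have V: "\<gamma> 0 \<in> V" "\<gamma> 1 \<in> V" using \<gamma>(3) by (auto simp: cell_vertices_def)
    have inside: "\<gamma> t \<in> e" if "0 < t" "t < 1" for t using that \<gamma>(2) by auto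
    have in_X: "\<gamma> t \<in> X - f0" if t: "t \<in> {0..1}" for t
    proof -
      consider "t = 0" | "t = 1" | "\<gamma> t \<in> e" using t inside[of t] by force
      then have "\<gamma> t \<in> V \<union> \<Union>E" using V e by cases auto
      then show ?thesis using decomposition(4,6,7) f0 by blast
    qed
    have N_open: "N (\<psi> (\<gamma> t)) = {\<gamma> 0, \<gamma> 1}" if "0 < t" "t < 1" for t
      using carrier_vertices_eq[of e "\<gamma> t"] inside[OF that] e in_X[of t] \<gamma>(3) \<psi>(2) that
      by (simp add: N_def cells_def)
    have N_end: "v \<in> N (\<psi> v)" if "v \<in> {\<gamma> 0, \<gamma> 1}" for v
    proof -
      have "v \<in> V" "v \<in> X - f0" using that V in_X[of 0] in_X[of 1] by auto
      then show ?thesis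
        using carrier_vertices_eq[of "{v}" v] \<psi>(2) by (simp add: N_def cells_def cell_vertices_def)
    qed
    have conn: "connected ((\<psi> \<circ> \<gamma>) ` J)" "(\<psi> \<circ> \<gamma>) ` J \<subseteq> R" if "J \<subseteq> {0..1}" "convex J" for J
    proof -
      have "continuous_on J (\<psi> \<circ> \<gamma>)"
        using that in_X by (intro continuous_on_compose continuous_on_subset[OF \<gamma>(1)]
          continuous_on_subset[OF \<psi>(1)]) auto
      then show "connected ((\<psi> \<circ> \<gamma>) ` J)"
        using that by (intro connected_continuous_image convex_connected)
      have "\<psi> (\<gamma> t) \<in> R" if "t \<in> J" for t using \<open>J \<subseteq> {0..1}\<close> that in_X[of t] R by blast
      then show "(\<psi> \<circ> \<gamma>) ` J \<subseteq> R" unfolding image_comp[symmetric] by blast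
    qed
    \<comment> \<open>The values attached to the two end points are transported to the midpoint,
      whose carrier is the whole edge. Each half-open path omits the opposite end, where the carrier
      shrinks to that end alone.\<close>
    let ?p = "\<psi> (\<gamma> (1 / 2))"
    have 0: "s (\<psi> (\<gamma> 0)) (\<gamma> 0) = s ?p (\<gamma> 0)"
    proof (rule flat_section_constant[OF s conn[of "{0..<1}"]])
      fix x assume "x \<in> (\<psi> \<circ> \<gamma>) ` {0..<1}"
      then obtain t where "t \<in> {0..<1}" "x = \<psi> (\<gamma> t)" by auto
      then show "\<gamma> 0 \<in> N x" using N_open[of t] N_end[of "\<gamma> 0"] by (cases "t = 0") auto
    qed auto
    have 1: "s (\<psi> (\<gamma> 1)) (\<gamma> 1) = s ?p (\<gamma> 1)"
    proof (rule flat_section_constant[OF s conn[of "{0<..1}"]])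
      fix x assume "x \<in> (\<psi> \<circ> \<gamma>) ` {0<..1}"
      then obtain t where "t \<in> {0<..1}" "x = \<psi> (\<gamma> t)" by auto
      then show "\<gamma> 1 \<in> N x" using N_open[of t] N_end[of "\<gamma> 1"] by (cases "t = 1") auto
    qed auto
    have "?p \<in> R" using R in_X[of "1 / 2"] by auto
    then have "flat_on m B W (N ?p) (s ?p)" using s by (auto simp: flat_section_def)
    then show "flat_on m B W (cell_vertices V e) (\<lambda>v. s (\<psi> v) v)"
      unfolding N_open[of "1 / 2", simplified] \<gamma>(3) using 0 1
      by (subst flat_on_cong[of _ _ "s ?p"]) auto
  qed
qed

end

text \<open>Pushing away from the center of a cell.\<close>

lemma punctured_cell_retraction:
  fixes X f :: "'a::t2_space set"
  assumes X: "closed X" "closed (X - f)" "f \<subseteq> X"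
    and \<phi>: "homeomorphism (cball (0::complex) 1) (closure f) \<phi> \<phi>'" "\<phi> ` ball 0 1 = f"
  obtains \<rho> where "continuous_on (X - {\<phi> 0}) \<rho>" "\<rho> ` (X - {\<phi> 0}) \<subseteq> X - f"
    "\<And>x. x \<in> X - f \<Longrightarrow> \<rho> x = x"
proof -
  have cont: "continuous_on (cball 0 1) \<phi>" "continuous_on (closure f) \<phi>'"
    and im: "\<phi> ` cball 0 1 = closure f" "\<phi>' ` closure f = cball 0 1"
    and inv: "\<And>z. z \<in> cball 0 1 \<Longrightarrow> \<phi>' (\<phi> z) = z" "\<And>x. x \<in> closure f \<Longrightarrow> \<phi> (\<phi>' x) = x"
    using \<phi>(1) by (auto simp: homeomorphism_def)
  have cl: "closure f \<subseteq> X" using X by (simp add: closure_minimal)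
  \<comment> \<open>Radial projection to the boundary circle in the coordinates of the disk; it
    breaks down only at the center.\<close>
  define q where "q x = \<phi> (\<phi>' x /\<^sub>R norm (\<phi>' x))" for x
  define \<rho> where "\<rho> x = (if x \<in> X - f then x else q x)" for x
  let ?T = "closure f - {\<phi> 0}"
  have f0: "\<phi> 0 \<in> f" using \<phi>(2) by auto
  have un: "X - {\<phi> 0} = (X - f) \<union> ?T" using f0 cl closure_subset[of f] by auto
  have nz: "\<phi>' x \<noteq> 0" if "x \<in> ?T" for x using inv(2)[of x] that by force
  have sphere: "\<phi> z \<in> X - f" if "norm z = 1" for z
  proof -
    have "\<phi> z \<in> closure f" using that im(1) by auto
    moreover have "\<phi> z \<notin> f"
    proof
      assume "\<phi> z \<in> f"
      then obtain y where y: "y \<in> ball 0 1" "\<phi> z = \<phi> y" using \<phi>(2) by blast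
      have "\<phi>' (\<phi> z) = z" "\<phi>' (\<phi> y) = y" using inv(1) that y(1) by simp_all
      then have "z = y" using y(2) by metis
      then show False using that y(1) by simp
    qed
    ultimately show ?thesis using cl by blast
  qed
  show ?thesis
  proof (rule that[of \<rho>])
    show "continuous_on (X - {\<phi> 0}) \<rho>"
      unfolding un \<rho>_def
    proof (rule continuous_on_cases_local)
      have "X - f = ((X - f) \<union> ?T) \<inter> (X - f)" by blast
      then show "closedin (top_of_set ((X - f) \<union> ?T)) (X - f)"
        using X(2) by (metis closedin_closed_Int)
      have "?T = ((X - f) \<union> ?T) \<inter> closure f" using f0 by blast
      then show "closedin (top_of_set ((X - f) \<union> ?T)) ?T"
        by (metis closedin_closed_Int closed_closure)
      have "continuous_on ?T (\<lambda>x. \<phi>' x /\<^sub>R norm (\<phi>' x))"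
        using nz by (intro continuous_intros continuous_on_subset[OF cont(2)]) auto
      moreover have "\<phi>' x /\<^sub>R norm (\<phi>' x) \<in> cball 0 1" if "x \<in> ?T" for x
        using nz[OF that] by simp
      ultimately show "continuous_on ?T q"
        unfolding q_def by (intro continuous_on_compose2[OF cont(1)]) blast+
      \<comment> \<open>The two closed pieces meet only in boundary points of the cell, where
        \<open>norm (\<phi>' x) = 1\<close> and the projection fixes the point.\<close>
      fix x assume "x \<in> X - f \<and> x \<notin> X - f \<or> x \<in> ?T \<and> x \<in> X - f"
      then have x: "x \<in> closure f" "x \<notin> f" by auto
      have "\<phi>' x \<in> cball 0 1" "\<phi>' x \<notin> ball 0 1" using x im(2) inv(2)[of x] \<phi>(2) by (blast, force)
      then have "norm (\<phi>' x) = 1" by auto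
      then show "x = q x" using x inv(2) by (simp add: q_def)
    qed simp
    show "\<rho> ` (X - {\<phi> 0}) \<subseteq> X - f"
    proof (rule image_subsetI)
      fix x assume "x \<in> X - {\<phi> 0}"
      then consider "x \<in> X - f" | "x \<notin> X - f" "x \<in> ?T" using closure_subset[of f] by blast
      then show "\<rho> x \<in> X - f"
      proof cases
        case 2
        then have "norm (\<phi>' x /\<^sub>R norm (\<phi>' x)) = 1" using nz by simp
        then show ?thesis using sphere 2 by (simp add: \<rho>_def q_def)
      qed (simp add: \<rho>_def)
    qed
  qed (simp add: \<rho>_def)
qed

text \<open>Puncturing the sphere at the center of the tile gives a copy of the plane. The inclusion
  of the complement into it serves as \<open>\<psi>\<close>, and the radial retraction of the
  punctured sphere as \<open>h\<close>.\<close>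

lemma sphere_minus_tile_retract_of_plane:
  assumes "quadrilateral_tiling (sphere (0::real^3) 1) V E F B W" and f: "f \<in> F"
  obtains h :: "real \<times> real \<Rightarrow> real^3" and \<psi> where "continuous_on UNIV h"
    "range h \<subseteq> sphere 0 1 - f" "continuous_on (sphere 0 1 - f) \<psi>"
    "\<And>x. x \<in> sphere 0 1 - f \<Longrightarrow> h (\<psi> x) = x"
proof -
  interpret quad_tiling "sphere (0::real^3) 1" V E F B W by unfold_locales fact
  obtain \<phi> \<phi>' where \<phi>: "homeomorphism (cball (0::complex) 1) (closure f) \<phi> \<phi>'" "\<phi> ` ball 0 1 = f"
    using tiling f by (fastforce simp: quadrilateral_tiling_def embedded_polygon_def)
  have fX: "f \<subseteq> sphere 0 1" using decomposition(4) f by blast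
  have center: "\<phi> 0 \<in> f" using \<phi>(2) by auto
  obtain \<rho> where \<rho>: "continuous_on (sphere 0 1 - {\<phi> 0}) \<rho>" "\<rho> ` (sphere 0 1 - {\<phi> 0}) \<subseteq> sphere 0 1 - f"
    "\<And>x. x \<in> sphere 0 1 - f \<Longrightarrow> \<rho> x = x"
    using punctured_cell_retraction[OF _ closed_diff_tile[OF f] fX \<phi>] by (metis closed_sphere)
  have "(sphere (0::real^3) 1 - {\<phi> 0}) homeomorphic (UNIV :: (real \<times> real) set)"
    using center fX by (intro homeomorphic_punctured_sphere_affine) auto
  then obtain u u' where u: "homeomorphism (sphere 0 1 - {\<phi> 0}) (UNIV :: (real \<times> real) set) u u'"
    by (auto simp: homeomorphic_def)
  show ?thesis
  proof (rule that[of "\<rho> \<circ> u'" u])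
    show "continuous_on UNIV (\<rho> \<circ> u')"
      using u \<rho>(1) by (intro continuous_on_compose) (auto simp: homeomorphism_def)
    show "range (\<rho> \<circ> u') \<subseteq> sphere 0 1 - f"
      using u \<rho>(2) unfolding image_comp[symmetric] by (simp add: homeomorphism_def)
    show "continuous_on (sphere 0 1 - f) u"
      using u center by (auto simp: homeomorphism_def intro: continuous_on_subset)
    fix x assume x: "x \<in> sphere 0 1 - f"
    then have "x \<in> sphere 0 1 - {\<phi> 0}" using center by blast
    then have "u' (u x) = x" using u unfolding homeomorphism_def by blast
    then show "(\<rho> \<circ> u') (u x) = x" using \<rho>(3)[OF x] by simp
  qed
qed

section \<open>The incidence theorem\<close>

theorem theorem5p13:
  fixes V B W :: "(real ^ 3) set"
    and E F :: "(real ^ 3) set set"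
    and P H :: "real ^ 3 \<Rightarrow> ('d::division_ring ^ 'm::finite) set"
    and n :: nat
    and f0 :: "(real ^ 3) set"
  assumes tiling: "quadrilateral_tiling (sphere 0 1) V E F B W"
    and dim: "n \<ge> 1" "CARD('m) = n + 1"
    and realization: "tiling_realization V E B W P H"
    and tile: "f0 \<in> F"
    and others_coherent: "\<forall>f\<in>F - {f0}. coherent_tile B W P H f"
  shows "coherent_tile B W P H f0"
proof -
  interpret quad_tiling "sphere (0::real^3) 1" V E F B W by unfold_locales (fact tiling)
  have pt: "\<exists>a. a \<noteq> 0 \<and> P b = range (\<lambda>c. c *s a)" if "b \<in> B" for b
  proof -
    have "proj_point (P b)" using realization that by (auto simp: tiling_realization_def)
    then show ?thesis by (rule proj_pointE) blast
  qed
  define a where "a b = (SOME a. a \<noteq> 0 \<and> P b = range (\<lambda>c. c *s a))" for b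
  have a: "P b = range (\<lambda>c. c *s a b)" if "b \<in> B" for b
    unfolding a_def using someI_ex[OF pt[OF that]] by blast
  define \<phi> where "\<phi> w = (SOME \<phi>. left_functional \<phi> \<and> (\<forall>x. \<phi> x = 0 \<longleftrightarrow> x \<in> H w))" for w
  define m where "m b w = \<phi> w (a b)" for b w
  \<comment> \<open>A functional with kernel \<open>H w\<close> is built from a vector outside
    \<open>H w\<close>, and nonincidence along an edge supplies one in \<open>P b\<close>. Being a
    multiple of \<open>a b\<close>, it also shows that \<open>m b w\<close> is nonzero.\<close>
  have edge: "left_functional (\<phi> w) \<and> (\<forall>x. \<phi> w x = 0 \<longleftrightarrow> x \<in> H w) \<and> m b w \<noteq> 0"
    if e: "e \<in> E" "b \<in> B" "w \<in> W" "cell_vertices V e = {b, w}" for e b w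
  proof -
    have "\<not> P b \<subseteq> H w" "proj_hyperplane (H w)"
      using realization e by (auto simp: tiling_realization_def proj_incident_def)
    then obtain u where u: "u \<in> P b" "u \<notin> H w" by blast
    then obtain \<xi> where "left_functional \<xi>" "\<And>x. \<xi> x = 0 \<longleftrightarrow> x \<in> H w"
      using hyperplane_functional[OF \<open>proj_hyperplane (H w)\<close>] by metis
    then have "\<exists>\<phi>. left_functional \<phi> \<and> (\<forall>x. \<phi> x = 0 \<longleftrightarrow> x \<in> H w)" by blast
    from someI_ex[OF this] have \<phi>: "left_functional (\<phi> w)" "\<And>x. \<phi> w x = 0 \<longleftrightarrow> x \<in> H w"
      by (simp_all add: \<phi>_def)
    obtain c where "u = c *s a b" using u(1) a[OF e(2)] by blast
    then have "\<phi> w u = c * m b w" using left_functional_simps(2)[OF \<phi>(1)] by (simp add: m_def)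
    then have "m b w \<noteq> 0" using u(2) \<phi>(2)[of u] by auto
    with \<phi> show ?thesis by blast
  qed
  have coherent: "coherent_tile B W P H f \<longleftrightarrow> (\<exists>g. flat_on m B W (cell_vertices V f) g)"
    if f: "f \<in> F" for f
  proof -
    \<comment> \<open>Stated for arbitrary labels of the corners, because
      \<open>coherent_tile\<close> hides its own labelling under an existential quantifier.\<close>
    have eq: "coherent_quadruple (P b1) (P b2) (H w1) (H w2) \<longleftrightarrow>
        (\<exists>g. flat_on m B W (cell_vertices V f) g)"
      if f: "cell_vertices B f = {b1, b2}" "cell_vertices W f = {w1, w2}"
        and nb: "\<And>b w. b \<in> {b1, b2} \<Longrightarrow> w \<in> {w1, w2} \<Longrightarrow> \<exists>e\<in>E. cell_vertices V e = {b, w}"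
      for b1 b2 w1 w2
    proof -
      have BW: "{b1, b2} \<subseteq> B" "{w1, w2} \<subseteq> W"
        unfolding f[symmetric] by (auto simp: cell_vertices_def)
      have e: "left_functional (\<phi> w)" "\<And>x. \<phi> w x = 0 \<longleftrightarrow> x \<in> H w" "m b w \<noteq> 0"
        if "b \<in> {b1, b2}" "w \<in> {w1, w2}" for b w
        using nb[OF that] edge BW that by blast+
      have "coherent_quadruple (P b1) (P b2) (H w1) (H w2) \<longleftrightarrow>
          inverse (m b1 w1) * m b1 w2 = inverse (m b2 w1) * m b2 w2"
        unfolding m_def
        by (rule coherent_quadruple_iff) (use a BW e[of b1] e[of b2] in \<open>auto simp flip: m_def\<close>)
      also have "\<dots> \<longleftrightarrow> (\<exists>g. flat_on m B W (cell_vertices V f) g)"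
        using f colors e by (intro flat_on_quadrilateral[symmetric]) (auto simp: cell_vertices_def)
      finally show ?thesis .
    qed
    obtain b1 b2 w1 w2 where corners: "b1 \<noteq> b2" "w1 \<noteq> w2"
      "cell_vertices B f = {b1, b2}" "cell_vertices W f = {w1, w2}"
      "\<And>b w. b \<in> {b1, b2} \<Longrightarrow> w \<in> {w1, w2} \<Longrightarrow> \<exists>e\<in>E. cell_vertices V e = {b, w}"
      by (rule tile_corners[OF f]) blast
    show ?thesis
    proof
      assume "coherent_tile B W P H f"
      then obtain b1' b2' w1' w2' where c: "cell_vertices B f = {b1', b2'}"
        "cell_vertices W f = {w1', w2'}" "coherent_quadruple (P b1') (P b2') (H w1') (H w2')"
        unfolding coherent_tile_def by blast
      have "{b1', b2'} = {b1, b2}" "{w1', w2'} = {w1, w2}" using c corners by simp_all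
      then show "\<exists>g. flat_on m B W (cell_vertices V f) g"
        using eq[OF c(1,2)] c(3) corners(5) by simp
    next
      assume "\<exists>g. flat_on m B W (cell_vertices V f) g"
      then have "coherent_quadruple (P b1) (P b2) (H w1) (H w2)"
        using eq[OF corners(3-5)] by simp
      then show "coherent_tile B W P H f" unfolding coherent_tile_def using corners by blast
    qed
  qed
  obtain h :: "real \<times> real \<Rightarrow> real^3" and \<psi> where h: "continuous_on UNIV h"
    "range h \<subseteq> sphere 0 1 - f0" "continuous_on (sphere 0 1 - f0) \<psi>"
    "\<And>x. x \<in> sphere 0 1 - f0 \<Longrightarrow> h (\<psi> x) = x"
    by (rule sphere_minus_tile_retract_of_plane[OF tiling tile]) blast
  have "\<exists>g. flat_on m B W (cell_vertices V f) g" if "f \<in> F - {f0}" for f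
    using coherent others_coherent that by blast
  moreover have "m b w \<noteq> 0" if "e \<in> E" "b \<in> B" "w \<in> W" "cell_vertices V e = {b, w}" for e b w
    using edge[OF that] by blast
  ultimately obtain g where g: "\<And>e. e \<in> E \<Longrightarrow> flat_on m B W (cell_vertices V e) g"
    using flat_on_edges[OF tile compact_sphere h, of m] by metis
  obtain b1 b2 w1 w2 where corners: "cell_vertices B f0 = {b1, b2}" "cell_vertices W f0 = {w1, w2}"
    "b1 \<noteq> b2" "w1 \<noteq> w2"
    "\<And>b w. b \<in> {b1, b2} \<Longrightarrow> w \<in> {w1, w2} \<Longrightarrow> \<exists>e\<in>E. cell_vertices V e = {b, w}"
    by (rule tile_corners[OF tile]) blast
  have Vf0: "cell_vertices V f0 = cell_vertices B f0 \<union> cell_vertices W f0"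
    "B \<inter> cell_vertices V f0 = cell_vertices B f0" "W \<inter> cell_vertices V f0 = cell_vertices W f0"
    using colors by (auto simp: cell_vertices_def)
  \<comment> \<open>Each such pair of corners bounds an edge, where the edge potential
    \<open>g\<close> is available.\<close>
  have pair: "g b \<noteq> 0 \<and> g w \<noteq> 0 \<and> g w = g b * m b w" if bw: "b \<in> {b1, b2}" "w \<in> {w1, w2}" for b w
  proof -
    obtain e where e: "e \<in> E" "cell_vertices V e = {b, w}" using corners(5)[OF bw] by blast
    have "b \<in> B" "w \<in> W" using bw corners(1,2) by (auto simp: cell_vertices_def)
    then show ?thesis using g[OF e(1)] unfolding e(2) flat_on_def by blast
  qed
  have "flat_on m B W (cell_vertices V f0) g"
    unfolding flat_on_def Vf0(2,3) unfolding Vf0(1) corners(1,2) using pair by blast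
  then show ?thesis using coherent[OF tile] by blast
qed

end
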